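(* Let $n\ge 1$ and let $M^n$ be an $n$-dimensional real manifold with boundary $\partial M^n$. If $\partial M^n\neq\varnothing$, then every $C^1$ local action $\alpha$ of $SL_\circ(n+1,\mathbb{R})$ on $M^n$ is trivial.
   Context: Manifolds are real analytic, connected and metrizable. $SL_\circ(n+1,\mathbb{R})$ is the identity component of the group of real $(n+1)\times(n+1)$ matrices of determinant $1$. A $C^1$ local action $\alpha$ of a Lie group $G$ on $M$ is a homomorphism $g\mapsto g^\alpha$ from $G$ to the groupoid of $C^1$ diffeomorphisms between open subsets of $M$, so that $g^\alpha(h^\alpha(x))=(gh)^\alpha(x)$ whenever both sides are defined, such that the evaluation map $(g,x)\mapsto g^\alpha(x)$ defines a $C^1$ map $\Omega\to M$, where $\Omega$ is an open neighborhood of $\{e\}\times M$ in $G\times M$. The local action is trivial if every $g^\alpha$ is the identity where it is defined.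
   Formalization: As stated the claim fails: g^α may be arbitrary for g away from e. Proved instead: every g^α(x) with g in the identity component of {g : g^α(x) is defined} equals x; so α is trivial if these sets are connected for all x. *)

theory Defs
  imports "HOL-Analysis.Analysis"
begin

section \<open>Analytic and \<open>C\<^sup>1\<close> functions on subsets of Euclidean space\<close>

text \<open>
  Both notions are applied to sets with boundary, such as relatively open subsets of a closed
  half-space. As usual, regularity there means that near each point of \<open>S\<close> the function is the
  restriction of a regular function defined on a full neighbourhood of the point.
\<close>

text \<open>Power series in several variables are sums over all multi-indices \<open>\<nu> :: 'n \<Rightarrow> nat\<close>.\<close>

definition real_analytic_on_set :: "(real^'n \<Rightarrow> real^'p) \<Rightarrow> (real^'n) set \<Rightarrow> bool" where
  "real_analytic_on_set f S \<longleftrightarrow>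
     (\<forall>p\<in>S. \<exists>r>0. \<exists>c F. \<forall>x\<in>ball p r.
        ((\<lambda>\<nu>::'n \<Rightarrow> nat. (\<Prod>i\<in>UNIV. (x$i - p$i) ^ \<nu> i) *\<^sub>R c \<nu>) has_sum F x) UNIV
        \<and> (x \<in> S \<longrightarrow> F x = f x))"

definition C1_on_set :: "('a::euclidean_space \<Rightarrow> 'b::euclidean_space) \<Rightarrow> 'a set \<Rightarrow> bool" where
  "C1_on_set f S \<longleftrightarrow>
     (\<forall>p\<in>S. \<exists>W F. \<exists>F' :: 'a \<Rightarrow> 'a \<Rightarrow>\<^sub>L 'b. open W \<and> p \<in> W
        \<and> (\<forall>x\<in>W. (F has_derivative blinfun_apply (F' x)) (at x))
        \<and> continuous_on W F'
        \<and> (\<forall>x\<in>W \<inter> S. F x = f x))"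


section \<open>Real analytic manifolds with boundary\<close>

text \<open>
  The model space is a coordinate half-space of \<open>\<real>\<^sup>n\<close>, with \<open>n = CARD('n)\<close>; the coordinate \<open>k\<close>
  that is nonnegative on it is a parameter of everything below. Charts are pairs of a domain and a
  coordinate function whose values outside the domain are irrelevant. A chart whose image avoids
  the bounding hyperplane is an interior chart.
\<close>

definition half_space :: "'n \<Rightarrow> (real^'n) set" where
  "half_space k = {y. 0 \<le> y$k}"

type_synonym ('a, 'n) chart = "'a set \<times> ('a \<Rightarrow> real^'n)"

definition is_chart :: "'n \<Rightarrow> 'a topology \<Rightarrow> ('a, 'n::finite) chart \<Rightarrow> bool" where
  "is_chart k M = (\<lambda>(U, \<phi>). openin M U
     \<and> openin (top_of_set (half_space k)) (\<phi> ` U)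
     \<and> homeomorphic_map (subtopology M U) (top_of_set (\<phi> ` U)) \<phi>)"

definition analytic_atlas :: "'n \<Rightarrow> 'a topology \<Rightarrow> ('a, 'n::finite) chart set \<Rightarrow> bool" where
  "analytic_atlas k M A \<longleftrightarrow>
     (\<forall>c\<in>A. is_chart k M c)
     \<and> (\<Union>(U, \<phi>)\<in>A. U) = topspace M
     \<and> (\<forall>(U, \<phi>)\<in>A. \<forall>(V, \<psi>)\<in>A. real_analytic_on_set (\<psi> \<circ> inv_into U \<phi>) (\<phi> ` (U \<inter> V)))"

definition analytic_manifold_with_boundary ::
    "'n \<Rightarrow> 'a topology \<Rightarrow> ('a, 'n::finite) chart set \<Rightarrow> bool" where
  "analytic_manifold_with_boundary k M A \<longleftrightarrow>
     metrizable_space M \<and> connected_space M \<and> analytic_atlas k M A"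

definition manifold_boundary :: "'n \<Rightarrow> ('a, 'n::finite) chart set \<Rightarrow> 'a set" where
  "manifold_boundary k A = {x. \<exists>(U, \<phi>)\<in>A. x \<in> U \<and> \<phi> x $ k = 0}"


section \<open>\<open>C\<^sup>1\<close> maps and diffeomorphisms between open subsets\<close>

definition C1_map_on ::
    "'a topology \<Rightarrow> ('a, 'n::finite) chart set \<Rightarrow> 'a set \<Rightarrow> ('a \<Rightarrow> 'a) \<Rightarrow> bool" where
  "C1_map_on M A D f \<longleftrightarrow>
     continuous_map (subtopology M D) M f
     \<and> (\<forall>(U, \<phi>)\<in>A. \<forall>(V, \<psi>)\<in>A.
          C1_on_set (\<psi> \<circ> f \<circ> inv_into U \<phi>) (\<phi> ` {x \<in> U \<inter> D. f x \<in> V}))"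

text \<open>Partial maps carry their domain \<^term>\<open>dom f\<close>, which may be empty.\<close>

definition C1_partial_diffeo ::
    "'a topology \<Rightarrow> ('a, 'n::finite) chart set \<Rightarrow> ('a \<rightharpoonup> 'a) \<Rightarrow> bool" where
  "C1_partial_diffeo M A f \<longleftrightarrow>
     openin M (dom f) \<and> openin M (ran f) \<and> inj_on f (dom f)
     \<and> C1_map_on M A (dom f) (the \<circ> f)
     \<and> C1_map_on M A (ran f) (inv_into (dom f) (the \<circ> f))"


section \<open>Local actions of matrix groups\<close>

definition SL0 :: "(real^'m^'m) set" where
  "SL0 = connected_component_set {g. det g = 1} (mat 1)"

text \<open>
  The set \<open>\<Omega>\<close>. The group \<open>G\<close> is thought of as an embedded Lie subgroup of the invertible matrices,
  so \<^const>\<open>C1_on_set\<close>, with local extensions to the space of all matrices, gives the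
  \<open>C\<^sup>1\<close> maps on open subsets of \<open>G \<times> M\<close>.
\<close>

definition action_domain ::
    "(real^'m^'m) set \<Rightarrow> (real^'m^'m \<Rightarrow> 'a \<rightharpoonup> 'a) \<Rightarrow> ((real^'m^'m) \<times> 'a) set" where
  "action_domain G \<alpha> = {(g, x). g \<in> G \<and> x \<in> dom (\<alpha> g)}"

definition C1_evaluation ::
    "'a topology \<Rightarrow> ('a, 'n::finite) chart set \<Rightarrow> (real^'m^'m) set
      \<Rightarrow> (real^'m^'m \<Rightarrow> 'a \<rightharpoonup> 'a) \<Rightarrow> bool" where
  "C1_evaluation M A G \<alpha> \<longleftrightarrow>
     continuous_map (subtopology (prod_topology (top_of_set G) M) (action_domain G \<alpha>)) M
       (\<lambda>(g, x). the (\<alpha> g x))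
     \<and> (\<forall>(U, \<phi>)\<in>A. \<forall>(V, \<psi>)\<in>A.
          C1_on_set (\<lambda>(g, y). \<psi> (the (\<alpha> g (inv_into U \<phi> y))))
            {(g, \<phi> x) | g x. (g, x) \<in> action_domain G \<alpha> \<and> x \<in> U \<and> the (\<alpha> g x) \<in> V})"

text \<open>
  The domain of \<open>\<alpha> (g ** h)\<close> need not be related to that of the composition of \<open>\<alpha> g\<close> and
  \<open>\<alpha> h\<close>. That \<open>\<alpha> (mat 1)\<close> is the identity of \<open>M\<close> is a consequence, since it is injective and
  idempotent with domain \<open>M\<close>.
\<close>

definition C1_local_action ::
    "'a topology \<Rightarrow> ('a, 'n::finite) chart set \<Rightarrow> (real^'m^'m) set
      \<Rightarrow> (real^'m^'m \<Rightarrow> 'a \<rightharpoonup> 'a) \<Rightarrow> bool" where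
  "C1_local_action M A G \<alpha> \<longleftrightarrow>
     (\<forall>g\<in>G. C1_partial_diffeo M A (\<alpha> g))
     \<and> (\<forall>g\<in>G. \<forall>h\<in>G. \<forall>x y z w.
          \<alpha> h x = Some y \<longrightarrow> \<alpha> g y = Some z \<longrightarrow> \<alpha> (g ** h) x = Some w \<longrightarrow> z = w)
     \<and> openin (prod_topology (top_of_set G) M) (action_domain G \<alpha>)
     \<and> {mat 1} \<times> topspace M \<subseteq> action_domain G \<alpha>
     \<and> C1_evaluation M A G \<alpha>"

definition trivial_local_action ::
    "(real^'m^'m) set \<Rightarrow> (real^'m^'m \<Rightarrow> 'a \<rightharpoonup> 'a) \<Rightarrow> bool" where
  "trivial_local_action G \<alpha> \<longleftrightarrow> (\<forall>g\<in>G. \<forall>x\<in>dom (\<alpha> g). \<alpha> g x = Some x)"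

text \<open>
  The axioms say nothing about how \<open>\<alpha> g\<close>, for \<open>g\<close> in a component of \<open>{g \<in> G. x \<in> dom (\<alpha> g)}\<close> not
  containing the identity, is related to the action near the identity: on such components one may
  add unrelated diffeomorphisms to a local action. The part connected to the identity is
  the following restriction, again a local action, which is all of \<open>\<alpha>\<close> when
  these sets are connected (for instance for global actions of connected groups).
\<close>

definition group_slice ::
    "(real^'m^'m) set \<Rightarrow> (real^'m^'m \<Rightarrow> 'a \<rightharpoonup> 'a) \<Rightarrow> 'a \<Rightarrow> (real^'m^'m) set" where
  "group_slice G \<alpha> x = {g \<in> G. x \<in> dom (\<alpha> g)}"

definition identity_part ::
    "(real^'m^'m) set \<Rightarrow> (real^'m^'m \<Rightarrow> 'a \<rightharpoonup> 'a) \<Rightarrow> (real^'m^'m \<Rightarrow> 'a \<rightharpoonup> 'a)" where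
  "identity_part G \<alpha> g = \<alpha> g |` {x. g \<in> connected_component_set (group_slice G \<alpha> x) (mat 1)}"

end

theory Submission
  imports Defs
begin

text \<open>
  Let \<open>x\<close> be a boundary point. The coordinate transverse to the boundary is minimal along each orbit
  curve through \<open>x\<close>, so the orbit map at \<open>x\<close> has rank at most \<open>n - 1\<close>. Its kernel is a subalgebra of
  \<open>sl\<^sub>n\<^sub>+\<^sub>1\<close>, which has no proper subalgebra of codimension below \<open>n\<close>; hence all boundary points are
  fixed. The isotropy representation at \<open>x\<close> is then the identity on the boundary, so it has solvable
  image, and it is trivial because the group is perfect. By Thurston's stability theorem for \<open>C\<^sup>1\<close>
  actions of perfect groups the points near \<open>x\<close> are fixed. The interior of the set of fixed points is also closed:
  at a limit point the isotropy representation is trivial by continuity of the derivative, and the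
  stability argument applies again. As \<open>M\<close> is connected, all points are fixed.
\<close>

section \<open>Matrices of determinant one\<close>

text \<open>As the evaluation map is only C1, the velocity \<open>\<rho> y X\<close> is merely
  continuous in \<open>y\<close>: these vector fields have no Lie brackets, and their integral
  curves need not be unique. Infinitesimal facts are therefore drawn from the group law, by
  differentiating single curves at single points. Closure of the kernel of \<open>\<rho> y\<close>
  under brackets is needed only when one of the two elements is \<open>outer u w\<close> with
  \<open>u \<bullet> w = 0\<close>; its one-parameter group is the polynomial curve
  \<open>mat 1 + t *\<^sub>R outer u w\<close>, so no exponential map occurs. At a boundary point
  the kernel is cut out by n - 1 velocity components and the trace, hence by n conditions, one fewer
  than the matrix size n + 1. Since nothing is known about the domains of the maps
  \<open>\<alpha> g\<close>, the local arguments concern only \<open>g\<close> near the identity;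
  the result is then carried along the component of the identity in the slice of each point.\<close>

lemma bounded_bilinear_matrix_mult:
  "bounded_bilinear ((**) :: real^'n^'m \<Rightarrow> real^'p^'n \<Rightarrow> real^'p^'m)"
proof -
  have "bilinear ((**) :: real^'n^'m \<Rightarrow> real^'p^'n \<Rightarrow> real^'p^'m)"
    by (auto simp: bilinear_def linear_iff matrix_add_ldistrib matrix_matrix_mult_def vec_eq_iff
        sum.distrib sum_distrib_left algebra_simps)
  then show ?thesis
    by (simp add: bilinear_conv_bounded_bilinear)
qed

lemmas matrix_mult_simps =
  bounded_bilinear.add_left[OF bounded_bilinear_matrix_mult]
  bounded_bilinear.add_right[OF bounded_bilinear_matrix_mult]
  bounded_bilinear.diff_left[OF bounded_bilinear_matrix_mult]
  bounded_bilinear.diff_right[OF bounded_bilinear_matrix_mult]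
  bounded_bilinear.minus_left[OF bounded_bilinear_matrix_mult]
  bounded_bilinear.minus_right[OF bounded_bilinear_matrix_mult]
  bounded_bilinear.scaleR_left[OF bounded_bilinear_matrix_mult]
  bounded_bilinear.scaleR_right[OF bounded_bilinear_matrix_mult]
  bounded_bilinear.zero_left[OF bounded_bilinear_matrix_mult]
  bounded_bilinear.zero_right[OF bounded_bilinear_matrix_mult]

lemma tendsto_matrix_mult:
  fixes f :: "'a \<Rightarrow> real^'n^'m" and g :: "'a \<Rightarrow> real^'p^'n"
  shows "(f \<longlongrightarrow> a) G \<Longrightarrow> (g \<longlongrightarrow> b) G \<Longrightarrow> ((\<lambda>x. f x ** g x) \<longlongrightarrow> a ** b) G"
  by (rule bounded_bilinear.tendsto[OF bounded_bilinear_matrix_mult])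

lemma continuous_on_matrix_mult:
  fixes f :: "'a::topological_space \<Rightarrow> real^'n^'m" and g :: "'a \<Rightarrow> real^'p^'n"
  shows "continuous_on S f \<Longrightarrow> continuous_on S g \<Longrightarrow> continuous_on S (\<lambda>x. f x ** g x)"
  by (rule bounded_bilinear.continuous_on[OF bounded_bilinear_matrix_mult])

lemma bounded_linear_matrix_mult_left: "bounded_linear (\<lambda>X::real^'p^'n. (A::real^'n^'m) ** X)"
  by (rule bounded_bilinear.bounded_linear_right[OF bounded_bilinear_matrix_mult])

lemma bounded_linear_matrix_mult_right: "bounded_linear (\<lambda>X::real^'n^'m. X ** (A::real^'p^'n))"
  by (rule bounded_bilinear.bounded_linear_left[OF bounded_bilinear_matrix_mult])

lemma bounded_linear_trace: "bounded_linear (trace :: real^'n^'n \<Rightarrow> real)"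
proof -
  have "linear (trace :: real^'n^'n \<Rightarrow> real)"
    by (auto simp: linear_iff trace_def sum.distrib sum_distrib_left)
  then show ?thesis by (rule linear_conv_bounded_linear[THEN iffD1])
qed

lemma differentiable_det: "(det :: real^'n^'n \<Rightarrow> real) differentiable (at A)"
proof -
  have "\<And>i j. ((\<lambda>X::real^'n^'n. X $ i $ j) has_derivative (\<lambda>X. X $ i $ j)) (at A)"
    by (intro bounded_linear_imp_has_derivative bounded_linear_compose[OF bounded_linear_vec_nth bounded_linear_vec_nth])
  then show ?thesis
    unfolding det_def differentiable_def by (intro exI) (rule derivative_intros | assumption)+
qed

text \<open>In the product rule only the identity permutation survives: any other one moves at least
  two indices, so after one factor is differentiated an off-diagonal zero of the identity matrix is
  still left in the product.\<close>

lemma has_derivative_det_mat_1: "((det :: real^'n^'n \<Rightarrow> real) has_derivative trace) (at (mat 1))"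
proof -
  have lin: "((\<lambda>X::real^'n^'n. X $ i $ j) has_derivative (\<lambda>X. X $ i $ j)) (at A)" for i j A
    by (intro bounded_linear_imp_has_derivative bounded_linear_compose[OF bounded_linear_vec_nth bounded_linear_vec_nth])
  let ?P = "{p. p permutes (UNIV::'n set)}"
  let ?D = "\<lambda>H::real^'n^'n. \<Sum>p\<in>?P. of_int (sign p) *
      (\<Sum>i\<in>UNIV. H $ i $ p i * (\<Prod>j\<in>UNIV - {i}. (mat 1 :: real^'n^'n) $ j $ p j))"
  have "(det has_derivative ?D) (at (mat 1))"
    unfolding det_def by (intro derivative_intros lin)
  moreover have "?D = trace"
  proof
    fix H :: "real^'n^'n"
    have z: "(\<Prod>j\<in>UNIV - {i}. (mat 1 :: real^'n^'n) $ j $ p j) = 0"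
      if p: "p permutes UNIV" "p \<noteq> id" for p :: "'n \<Rightarrow> 'n" and i
    proof -
      obtain a where a: "p a \<noteq> a" using p(2) by (auto simp: fun_eq_iff)
      have "\<exists>j. j \<noteq> i \<and> p j \<noteq> j"
      proof (cases "a = i")
        case True
        have "p (p a) \<noteq> p a" using a p(1) by (metis permutes_inv_o(2) comp_apply id_apply)
        then show ?thesis using a True by blast
      qed (use a in blast)
      then obtain j where "j \<noteq> i" "p j \<noteq> j" by blast
      then show ?thesis by (intro prod_zero) (auto simp: mat_def intro!: bexI[of _ j])
    qed
    have "?D H = (\<Sum>p\<in>{id}. of_int (sign p) *
      (\<Sum>i\<in>UNIV. H $ i $ p i * (\<Prod>j\<in>UNIV - {i}. (mat 1 :: real^'n^'n) $ j $ p j)))"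
      by (rule sum.mono_neutral_right) (auto simp: permutes_id z intro!: sum.neutral)
    also have "\<dots> = trace H"
      by (simp add: mat_def trace_def)
    finally show "?D H = trace H" .
  qed
  ultimately show ?thesis by simp
qed

lemma continuous_on_det: "continuous_on S (det :: real^'n^'n \<Rightarrow> real)"
  by (meson continuous_at_imp_continuous_on differentiable_imp_continuous_within differentiable_det)

lemma det_scaleR: "det (c *\<^sub>R (A :: real^'n^'n)) = c ^ CARD('n) * det A"
proof -
  have "c *\<^sub>R A = (\<chi> i. c *s A $ i)" by (simp add: vec_eq_iff vector_scalar_mult_def)
  then show ?thesis using det_rows_mul[of "\<lambda>i. c" "\<lambda>i. A $ i"] by simp
qed

text \<open>Rescaling to determinant one. It turns straight lines through the identity into curves
  in the group and so takes the place of the exponential map.\<close>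

definition unimodular :: "real^'n^'n \<Rightarrow> real^'n^'n" where
  "unimodular A = (det A powr (- 1 / CARD('n))) *\<^sub>R A"

lemma det_unimodular:
  assumes "det (A::real^'n^'n) > 0" shows "det (unimodular A) = 1"
proof -
  have "(det A powr (- 1 / CARD('n))) ^ CARD('n) = det A powr (-1)"
    using assms by (simp add: powr_realpow[symmetric] powr_powr)
  then show ?thesis using assms
    by (simp add: unimodular_def det_scaleR powr_minus)
qed

lemma unimodular_id: "det A = 1 \<Longrightarrow> unimodular A = A"
  by (simp add: unimodular_def)

lemma differentiable_unimodular:
  assumes "det (A::real^'n^'n) > 0"
  shows "(unimodular :: real^'n^'n \<Rightarrow> real^'n^'n) differentiable (at A)"
proof -
  obtain D where D: "((det :: real^'n^'n \<Rightarrow> real) has_derivative D) (at A)"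
    using differentiable_det[of A] by (auto simp: differentiable_def)
  have "((\<lambda>X. det X powr (- 1 / CARD('n))) has_derivative
      (\<lambda>H. (- 1 / CARD('n) * det A powr (- 1 / CARD('n) - 1)) * D H)) (at A)"
    using diff_chain_at[OF D has_real_derivative_powr[OF assms, of "- 1 / CARD('n)",
        THEN has_field_derivative_imp_has_derivative]]
    by (simp add: o_def)
  from has_derivative_scaleR[OF this has_derivative_ident] show ?thesis
    unfolding unimodular_def differentiable_def by blast
qed

lemma has_derivative_unimodular_mat_1:
  "((unimodular :: real^'n^'n \<Rightarrow> real^'n^'n) has_derivative (\<lambda>H. H - (trace H / CARD('n)) *\<^sub>R mat 1)) (at (mat 1))"
  unfolding unimodular_def
  by (rule derivative_eq_intros has_derivative_det_mat_1 refl | simp)+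

lemma matrix_inv_left_right:
  fixes A :: "real^'n^'n" assumes "det A = 1"
  shows "A ** matrix_inv A = mat 1" "matrix_inv A ** A = mat 1" "det (matrix_inv A) = 1"
proof -
  show *: "A ** matrix_inv A = mat 1" "matrix_inv A ** A = mat 1"
    using assms invertible_det_nz[of A]
    unfolding invertible_def matrix_inv_def by (metis (mono_tags, lifting) someI_ex zero_neq_one)+
  have "det (A ** matrix_inv A) = 1" by (simp add: *)
  then show "det (matrix_inv A) = 1" using assms by (simp add: det_mul)
qed

section \<open>The identity component as a group, and curves in it\<close>

lemma mat_1_in_SL0: "mat 1 \<in> (SL0 :: (real^'m^'m) set)"
  unfolding SL0_def by (simp add: connected_component_refl)

lemma det_SL0: "g \<in> SL0 \<Longrightarrow> det g = 1"
  unfolding SL0_def using connected_component_subset by blast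

text \<open>Right translation by \<open>h\<close> carries \<open>SL0\<close> to a connected set of
  matrices of determinant one that contains \<open>h\<close>, and contains \<open>mat 1\<close> in
  the second case, so it stays in one component. The two alternatives for \<open>h\<close> serve
  closure under products and under inverses.\<close>

lemma SL0_right_translate:
  fixes h :: "real^'m^'m"
  assumes "h \<in> SL0 \<or> (\<exists>g\<in>SL0. g ** h = mat 1)" "g \<in> SL0"
  shows "g ** h \<in> SL0"
proof -
  let ?T = "(\<lambda>g. g ** h) ` (SL0 :: (real^'m^'m) set)"
  have dh: "det h = 1"
    using assms(1) det_SL0 by (metis det_I det_mul mult_1)
  have "connected ?T"
    unfolding SL0_def
    by (intro connected_continuous_image continuous_on_matrix_mult continuous_intros) simp
  moreover have "?T \<subseteq> {g. det g = 1}" using dh by (auto simp: det_mul det_SL0)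
  moreover have "h \<in> ?T" using mat_1_in_SL0 by (metis image_eqI matrix_mul_lid)
  ultimately have sub: "?T \<subseteq> connected_component_set {g. det g = 1} h"
    by (intro connected_component_maximal)
  have "connected_component_set {g. det g = 1} h = SL0"
    using assms(1)
  proof
    assume "h \<in> SL0"
    then show ?thesis unfolding SL0_def
      by (metis connected_component_eq)
  next
    assume "\<exists>g\<in>SL0. g ** h = mat 1"
    then have "mat 1 \<in> ?T" by (metis image_eqI)
    then have "mat 1 \<in> connected_component_set {g. det g = 1} h" using sub by blast
    then show ?thesis unfolding SL0_def
      by (metis connected_component_eq)
  qed
  then show ?thesis using sub assms(2) by blast
qed

lemma SL0_mult: "g \<in> SL0 \<Longrightarrow> h \<in> SL0 \<Longrightarrow> g ** h \<in> (SL0 :: (real^'m^'m) set)"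
  by (simp add: SL0_right_translate)

lemma SL0_matrix_inv:
  assumes "g \<in> (SL0 :: (real^'m^'m) set)" shows "matrix_inv g \<in> SL0"
  using SL0_right_translate[of "matrix_inv g" "mat 1"] matrix_inv_left_right[OF det_SL0[OF assms]]
    assms mat_1_in_SL0 by auto

text \<open>The path is the segment from \<open>mat 1\<close> to \<open>g\<close>, rescaled by
  \<open>unimodular\<close>. The segment stays within \<open>\<eta>\<close> of the identity, and
  continuity of \<open>unimodular\<close> and \<open>det\<close> there yields the bound
  \<open>\<delta>\<close> and a positive determinant.\<close>

lemma unimodular_path:
  fixes \<delta> :: real assumes "\<delta> > 0"
  obtains \<eta> where "\<eta> > 0" and
    "\<And>g :: real^'m^'m. det g = 1 \<Longrightarrow> norm (g - mat 1) < \<eta> \<Longrightarrow>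
      \<exists>\<gamma> \<gamma>'. \<gamma> 0 = mat 1 \<and> \<gamma> 1 = g \<and> (\<forall>t\<in>{0..1}. (\<gamma> has_vector_derivative \<gamma>' t) (at t)
        \<and> det (\<gamma> t) = 1 \<and> norm (\<gamma> t - mat 1) < \<delta>)"
proof -
  have "isCont (unimodular :: real^'m^'m \<Rightarrow> _) (mat 1)"
    by (intro differentiable_imp_continuous_within differentiable_unimodular) simp
  then have "((unimodular :: real^'m^'m \<Rightarrow> _) \<longlongrightarrow> unimodular (mat 1)) (nhds (mat 1))"
    by (simp only: isCont_def tendsto_at_iff_tendsto_nhds)
  then have "((unimodular :: real^'m^'m \<Rightarrow> _) \<longlongrightarrow> mat 1) (nhds (mat 1))"
    by (simp add: unimodular_id)
  then have 1: "\<forall>\<^sub>F A in nhds (mat 1 :: real^'m^'m). dist (unimodular A) (mat 1) < \<delta>"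
    using assms by (auto dest: tendstoD)
  have "isCont (det :: real^'m^'m \<Rightarrow> _) (mat 1)"
    by (intro differentiable_imp_continuous_within differentiable_det)
  then have "((det :: real^'m^'m \<Rightarrow> _) \<longlongrightarrow> det (mat 1 :: real^'m^'m)) (nhds (mat 1))"
    by (simp only: isCont_def tendsto_at_iff_tendsto_nhds)
  then have 2: "\<forall>\<^sub>F A in nhds (mat 1 :: real^'m^'m). det A > 0"
    by (rule order_tendstoD) simp
  obtain \<eta> where \<eta>: "\<eta> > 0"
    "\<And>A :: real^'m^'m. dist A (mat 1) < \<eta> \<Longrightarrow> dist (unimodular A) (mat 1) < \<delta> \<and> det A > 0"
    using eventually_conj[OF 1 2] unfolding eventually_nhds_metric by blast
  show ?thesis
  proof (rule that[OF \<eta>(1)])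
    fix g :: "real^'m^'m" assume g: "det g = 1" "norm (g - mat 1) < \<eta>"
    let ?l = "\<lambda>t::real. mat 1 + t *\<^sub>R (g - mat 1)"
    let ?\<gamma> = "\<lambda>t. unimodular (?l t)"
    have n: "dist (?l t) (mat 1) < \<eta>" if "t \<in> {0..1}" for t
    proof -
      have "\<bar>t\<bar> * norm (g - mat 1) \<le> norm (g - mat 1)" using that by (simp add: mult_left_le_one_le)
      then show ?thesis using g by (simp add: dist_norm)
    qed
    have "\<exists>D. (?\<gamma> has_vector_derivative D) (at t)" if t: "t \<in> {0..1}" for t
    proof -
      obtain D where D: "(unimodular has_derivative D) (at (?l t))"
        using differentiable_unimodular[of "?l t"] \<eta>(2)[OF n[OF t]] by (auto simp: differentiable_def)
      have l: "(?l has_derivative (\<lambda>s. s *\<^sub>R (g - mat 1))) (at t)"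
        by (auto intro!: derivative_eq_intros)
      have "(?\<gamma> has_derivative (\<lambda>s. D (s *\<^sub>R (g - mat 1)))) (at t)"
        using diff_chain_at[OF l D] by (simp add: o_def)
      moreover have "(\<lambda>s. D (s *\<^sub>R (g - mat 1))) = (\<lambda>s. s *\<^sub>R D (g - mat 1))"
        using has_derivative_bounded_linear[OF D] by (simp add: linear_simps)
      ultimately show ?thesis by (auto simp: has_vector_derivative_def)
    qed
    then obtain \<gamma>' where "\<forall>t\<in>{0..1}. (?\<gamma> has_vector_derivative \<gamma>' t) (at t)" by metis
    then show "\<exists>\<gamma> \<gamma>'. \<gamma> 0 = mat 1 \<and> \<gamma> 1 = g \<and> (\<forall>t\<in>{0..1}. (\<gamma> has_vector_derivative \<gamma>' t) (at t)
        \<and> det (\<gamma> t) = 1 \<and> norm (\<gamma> t - mat 1) < \<delta>)"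
      using g \<eta>(2)[OF n]
      by (intro exI[of _ ?\<gamma>] exI[of _ \<gamma>']) (auto simp: unimodular_id det_unimodular dist_norm)
  qed
qed

text \<open>Near the identity the determinant alone decides membership in \<open>SL0\<close>, so the
  analysis in charts can leave connected components aside.\<close>

lemma SL0_near_mat_1:
  obtains \<eta> where "\<eta> > 0" "\<And>g :: real^'m^'m. det g = 1 \<Longrightarrow> norm (g - mat 1) < \<eta> \<Longrightarrow> g \<in> SL0"
proof -
  obtain \<eta> where \<eta>: "\<eta> > 0" and
    *: "\<And>g :: real^'m^'m. det g = 1 \<Longrightarrow> norm (g - mat 1) < \<eta> \<Longrightarrow>
      \<exists>\<gamma> \<gamma>'. \<gamma> 0 = mat 1 \<and> \<gamma> 1 = g \<and> (\<forall>t\<in>{0..1}. (\<gamma> has_vector_derivative \<gamma>' t) (at t)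
        \<and> det (\<gamma> t) = 1 \<and> norm (\<gamma> t - mat 1) < 1)"
    using unimodular_path[of 1] by (metis zero_less_one)
  show ?thesis
  proof (rule that[OF \<eta>])
    fix g :: "real^'m^'m" assume g: "det g = 1" "norm (g - mat 1) < \<eta>"
    obtain \<gamma> \<gamma>' where \<gamma>: "\<gamma> 0 = mat 1" "\<gamma> 1 = g" "\<forall>t\<in>{0..1}. (\<gamma> has_vector_derivative \<gamma>' t) (at t)
        \<and> det (\<gamma> t) = 1 \<and> norm (\<gamma> t - mat 1) < 1" using *[OF g] by blast
    have "continuous_on {0..1} \<gamma>"
      using \<gamma>(3) by (meson continuous_at_imp_continuous_on has_vector_derivative_continuous)
    then have "connected (\<gamma> ` {0..1})" by (intro connected_continuous_image) auto
    moreover have "mat 1 \<in> \<gamma> ` {0..1}" using \<gamma>(1) by (metis atLeastAtMost_iff image_eqI order.refl zero_le_one)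
    moreover have "g \<in> \<gamma> ` {0..1}" using \<gamma>(2) by (metis atLeastAtMost_iff image_eqI order.refl zero_le_one)
    ultimately show "g \<in> SL0"
      unfolding SL0_def using \<gamma>(3) by (auto simp: connected_component_def)
  qed
qed

text \<open>At \<open>mat 1\<close> the derivative of \<open>unimodular\<close> removes the trace
  part of a direction, and \<open>Y\<close> has none; hence the rescaled line still has velocity
  \<open>Y\<close>.\<close>

lemma unimodular_curve:
  fixes Y :: "real^'m^'m" assumes "trace Y = 0"
  obtains \<gamma> where "\<gamma> 0 = mat 1" "(\<gamma> has_vector_derivative Y) (at 0)" "\<forall>\<^sub>F t in at 0. det (\<gamma> t) = 1"
proof -
  let ?l = "\<lambda>t::real. mat 1 + t *\<^sub>R Y"
  have l: "(?l has_derivative (\<lambda>s. s *\<^sub>R Y)) (at 0)"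
    by (auto intro!: derivative_eq_intros)
  have D: "(unimodular has_derivative (\<lambda>H. H - (trace H / CARD('m)) *\<^sub>R mat 1)) (at (?l 0))"
    using has_derivative_unimodular_mat_1 by simp
  have "((\<lambda>t. unimodular (?l t)) has_derivative (\<lambda>s. s *\<^sub>R Y)) (at 0)"
    using diff_chain_at[OF l D] assms linear_simps(5)[OF bounded_linear_trace, of _ Y]
    by (simp add: o_def)
  then have d: "((\<lambda>t. unimodular (?l t)) has_vector_derivative Y) (at 0)"
    by (simp add: has_vector_derivative_def)
  have "isCont (\<lambda>t. det (?l t)) 0"
    using continuous_on_compose2[OF continuous_on_det[of UNIV], of UNIV ?l]
    by (simp add: continuous_on_eq_continuous_at continuous_intros)
  then have "((\<lambda>t. det (?l t)) \<longlongrightarrow> 1) (at 0)" by (simp add: isCont_def)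
  then have 2: "\<forall>\<^sub>F t in at 0. det (?l t) > 0" by (rule order_tendstoD) simp
  show ?thesis
    using 2 d
    by (intro that[of "\<lambda>t. unimodular (?l t)"])
      (auto simp: unimodular_id det_unimodular elim!: eventually_mono)
qed

text \<open>Left translation by the inverse of \<open>\<gamma> t\<close> moves the path to the
  identity, where the derivative of \<open>det\<close> is the trace, while the determinant is
  constant along the path.\<close>

lemma trace_derivative_unimodular_path:
  fixes \<gamma> :: "real \<Rightarrow> real^'m^'m"
  assumes "(\<gamma> has_vector_derivative V) (at t)" "\<And>s. s \<in> {0..1} \<Longrightarrow> det (\<gamma> s) = 1"
    and "t \<in> {0..1}"
  shows "trace (matrix_inv (\<gamma> t) ** V) = 0"
proof -
  let ?T = "{0..1::real}"
  have i: "matrix_inv (\<gamma> t) ** \<gamma> t = mat 1" "det (matrix_inv (\<gamma> t)) = 1"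
    using matrix_inv_left_right assms by blast+
  let ?h = "\<lambda>s. matrix_inv (\<gamma> t) ** \<gamma> s"
  have h: "(?h has_derivative (\<lambda>s. matrix_inv (\<gamma> t) ** (s *\<^sub>R V))) (at t)"
    by (rule bounded_linear.has_derivative[OF bounded_linear_matrix_mult_left])
      (use assms(1) in \<open>simp add: has_vector_derivative_def\<close>)
  have d: "(det has_derivative trace) (at (?h t))"
    using has_derivative_det_mat_1 i by metis
  have "((\<lambda>s. det (?h s)) has_derivative (\<lambda>s. trace (matrix_inv (\<gamma> t) ** (s *\<^sub>R V)))) (at t)"
    using diff_chain_at[OF h d] by (simp add: o_def)
  \<comment> \<open>The determinant is known to be one only on the interval, so at its ends
    one-sided derivatives are compared.\<close>
  then have "((\<lambda>s. det (?h s)) has_vector_derivative trace (matrix_inv (\<gamma> t) ** V)) (at t within ?T)"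
    by (simp add: has_vector_derivative_def has_derivative_at_withinI matrix_mult_simps
        linear_simps(5)[OF bounded_linear_trace])
  moreover have "((\<lambda>s. det (?h s)) has_vector_derivative 0) (at t within ?T)"
    by (rule has_vector_derivative_transform[OF assms(3) _ has_vector_derivative_const[of 1]])
      (simp add: det_mul i assms)
  moreover have "at t within ?T \<noteq> bot"
    using assms(3) by (simp add: at_within_Icc_at trivial_limit_within islimpt_Icc)
  ultimately show ?thesis
    using vector_derivative_unique_within by blast
qed

section \<open>Subalgebras of small codimension\<close>

text \<open>Extend a basis of \<open>T\<close> to one of \<open>S\<close>: the images of the added
  vectors already span the image of \<open>S\<close>, and there are \<open>dim S - dim T\<close> of
  them.\<close>

lemma dim_eq_image_kernel_le:
  fixes f :: "'a::euclidean_space \<Rightarrow> 'b::euclidean_space"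
  assumes f: "linear f" and S: "subspace S" and T: "T \<subseteq> S" "subspace T" "\<And>x. x \<in> T \<Longrightarrow> f x = 0"
  shows "dim (f ` S) + dim T \<le> dim S"
proof -
  obtain B where B: "B \<subseteq> T" "independent B" "T \<subseteq> span B" "card B = dim T"
    using basis_exists by blast
  obtain B' where B': "B \<subseteq> B'" "B' \<subseteq> S" "independent B'" "S \<subseteq> span B'"
    using maximal_independent_subset_extend[of B S] B T by blast
  have fin: "finite B'" using B' independent_imp_finite by blast
  have "f ` S \<subseteq> span (f ` (B' - B))"
  proof
    fix y assume "y \<in> f ` S"
    then obtain x where x: "x \<in> S" "y = f x" by blast
    then have "f x \<in> f ` span B'" using B' by blast
    then have "f x \<in> span (f ` B')" using linear_span_image[OF f] by blast
    also have "f ` B' \<subseteq> insert 0 (f ` (B' - B))" using B T by auto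
    then have "span (f ` B') \<subseteq> span (f ` (B' - B))"
      by (metis span_mono span_insert_0)
    finally show "y \<in> span (f ` (B' - B))" using x by simp
  qed
  then have "dim (f ` S) \<le> card (f ` (B' - B))"
    by (intro dim_le_card) (use fin in auto)
  also have "\<dots> \<le> card (B' - B)" by (rule card_image_le) (use fin in auto)
  also have "\<dots> = dim S - dim T"
    using B B' fin by (metis card_Diff_subset basis_card_eq_dim finite_subset)
  finally show ?thesis
    using dim_subset[OF T(1)] by linarith
qed

section \<open>Rank one matrices and the entrywise inner product\<close>

definition outer :: "real^'n \<Rightarrow> real^'m \<Rightarrow> real^'m^'n" where
  "outer u w = (\<chi> i j. u $ i * w $ j)"

lemma outer_component [simp]: "outer u w $ i $ j = u $ i * w $ j"
  by (simp add: outer_def)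

lemma inner_outer: "outer u w \<bullet> Y = u \<bullet> (Y *v w)"
  by (simp add: inner_vec_def matrix_vector_mult_def sum_distrib_left mult_ac)

lemma inner_outer': "outer u w \<bullet> Y = w \<bullet> (transpose Y *v u)"
proof -
  have "outer u w \<bullet> Y = (\<Sum>i\<in>UNIV. \<Sum>j\<in>UNIV. u $ i * w $ j * Y $ i $ j)"
    by (simp add: inner_vec_def)
  also have "\<dots> = (\<Sum>j\<in>UNIV. \<Sum>i\<in>UNIV. u $ i * w $ j * Y $ i $ j)"
    by (rule sum.swap)
  finally show ?thesis
    by (simp add: inner_vec_def matrix_vector_mult_def sum_distrib_left transpose_def mult_ac)
qed

lemma outer_mult_left: "outer u w ** Y = outer u (transpose Y *v w)"
  by (simp add: vec_eq_iff matrix_matrix_mult_def matrix_vector_mult_def transpose_def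
      sum_distrib_left mult_ac)

lemma outer_mult_right: "Y ** outer u w = outer (Y *v u) w"
  by (simp add: vec_eq_iff matrix_matrix_mult_def matrix_vector_mult_def
      sum_distrib_left sum_distrib_right mult_ac)

lemma outer_mult_vec: "outer u w *v z = (w \<bullet> z) *\<^sub>R u"
  by (simp add: vec_eq_iff matrix_vector_mult_def inner_vec_def sum_distrib_left sum_distrib_right mult_ac)

lemma transpose_outer: "transpose (outer u w) = outer w u"
  by (simp add: vec_eq_iff transpose_def mult_ac)

lemma inner_transpose_mult:
  fixes X :: "real^'n^'m" shows "(X ** Z) \<bullet> Y = Z \<bullet> (transpose X ** Y)"
proof -
  have "(X ** Z) \<bullet> Y = (\<Sum>i\<in>UNIV. \<Sum>j\<in>UNIV. \<Sum>l\<in>UNIV. X $ i $ l * Z $ l $ j * Y $ i $ j)"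
    by (simp add: inner_vec_def matrix_matrix_mult_def sum_distrib_right)
  also have "\<dots> = (\<Sum>l\<in>UNIV. \<Sum>j\<in>UNIV. \<Sum>i\<in>UNIV. X $ i $ l * Z $ l $ j * Y $ i $ j)"
    by (subst sum.swap, subst (2) sum.swap, subst sum.swap) simp
  finally show ?thesis
    by (simp add: inner_vec_def matrix_matrix_mult_def sum_distrib_left transpose_def mult_ac)
qed

lemma inner_mult_transpose:
  fixes X :: "real^'n^'m" shows "(Z ** X) \<bullet> Y = Z \<bullet> (Y ** transpose X)"
proof -
  have "(Z ** X) \<bullet> Y = (\<Sum>i\<in>UNIV. \<Sum>j\<in>UNIV. \<Sum>l\<in>UNIV. Z $ i $ l * X $ l $ j * Y $ i $ j)"
    by (simp add: inner_vec_def matrix_matrix_mult_def sum_distrib_right)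
  also have "\<dots> = (\<Sum>i\<in>UNIV. \<Sum>l\<in>UNIV. \<Sum>j\<in>UNIV. Z $ i $ l * X $ l $ j * Y $ i $ j)"
    by (intro sum.cong refl sum.swap)
  finally show ?thesis
    by (simp add: inner_vec_def matrix_matrix_mult_def sum_distrib_left transpose_def mult_ac)
qed

lemma trace_eq_inner: "trace (X::real^'n^'n) = mat 1 \<bullet> X"
  by (simp add: trace_def inner_vec_def mat_def if_distrib[of "\<lambda>x. x * _"] cong: if_cong)

lemma trace_outer: "trace (outer u w) = u \<bullet> w"
  by (simp add: trace_def inner_vec_def)

text \<open>Every nonzero vector is an eigenvector of \<open>transpose Y\<close>. Testing on
  \<open>axis i 1\<close> kills the off-diagonal entries of row \<open>i\<close>; testing on
  \<open>axis i 1 + axis j 1\<close> makes the diagonal entries agree.\<close>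

lemma scalar_matrixI:
  fixes Y :: "real^'m^'m"
  assumes "\<And>u. transpose Y *v u \<in> span {u}"
  shows "Y \<in> span {mat 1}"
proof -
  have row: "\<exists>c. \<forall>l. (\<Sum>i\<in>UNIV. u $ i * Y $ i $ l) = c * u $ l" for u
  proof -
    obtain c where "transpose Y *v u = c *\<^sub>R u"
      using assms[of u] by (auto simp: span_singleton)
    then show ?thesis
      by (intro exI[of _ c]) (auto simp: vec_eq_iff matrix_vector_mult_def transpose_def mult_ac)
  qed
  have off: "Y $ i $ j = 0" if "i \<noteq> j" for i j
  proof -
    obtain c where c: "\<And>l. (\<Sum>a\<in>UNIV. axis i (1::real) $ a * Y $ a $ l) = c * axis i 1 $ l"
      using row by blast
    then show ?thesis
      using c[of j] that by (simp add: axis_def if_distrib[of "\<lambda>x. x * _"] cong: if_cong)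
  qed
  have diag: "Y $ i $ i = Y $ j $ j" for i j
  proof (cases "i = j")
    case False
    obtain c where c: "\<And>l. (\<Sum>a\<in>UNIV. (axis i (1::real) + axis j 1) $ a * Y $ a $ l) = c * (axis i 1 + axis j 1) $ l"
      using row by blast
    then have "Y $ i $ l + Y $ j $ l = c * (axis i 1 + axis j 1) $ l" for l
      using c[of l] by (simp add: axis_def distrib_right sum.distrib if_distrib[of "\<lambda>x. x * _"] cong: if_cong)
    from this[of i] this[of j] show ?thesis
      using False off by (simp add: axis_def)
  qed simp
  obtain i0 :: 'm where True by simp
  have "Y = Y $ i0 $ i0 *\<^sub>R mat 1"
    using off diag by (auto simp: vec_eq_iff mat_def)
  then show ?thesis by (metis span_base span_scale singletonI)
qed

text \<open>A subalgebra of \<open>sl\<^sub>N\<close> of codimension below \<open>N - 1\<close> is everything. Let \<open>P\<close> be its orthogonal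
  complement, scalars included, so \<open>dim P < N\<close>. If \<open>Y \<in> P\<close> and \<open>Y\<^sup>T u\<close> is not a multiple of \<open>u\<close>, then the
  rank one matrices \<open>u w\<^sup>T\<close> in the subalgebra are those with \<open>w\<close> orthogonal to \<open>P\<^sup>T u\<close>, and bracketing \<open>Y\<close>
  with them embeds \<open>(P\<^sup>T u)\<^sup>\<bottom>\<close> in the kernel of \<open>P \<rightarrow> P\<^sup>T u\<close>; thus \<open>dim P \<ge> N\<close>.\<close>

lemma no_small_codim_subalgebra:
  fixes S :: "(real^'m^'m) set"
  assumes S: "finite S" "card S < CARD('m)" "mat 1 \<in> S"
    and bracket: "\<And>u w Z b. (\<And>b. b \<in> S \<Longrightarrow> b \<bullet> outer u w = 0) \<Longrightarrow> (\<And>b. b \<in> S \<Longrightarrow> b \<bullet> Z = 0) \<Longrightarrow>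
        b \<in> S \<Longrightarrow> b \<bullet> (outer u w ** Z - Z ** outer u w) = 0"
    and b: "b \<in> S" and X: "trace X = 0"
  shows "b \<bullet> X = 0"
proof -
  define P where "P = span S"
  have dP: "dim P < CARD('m)"
    unfolding P_def using dim_le_card[OF order_refl S(1)] S(2) by linarith
  have SP: "b \<in> P" if "b \<in> S" for b using that by (simp add: P_def span_base)
  have PI: "mat 1 \<in> P" using S by (simp add: P_def span_base)
  have sP: "subspace P" by (simp add: P_def)
  have perp: "(\<forall>b\<in>S. b \<bullet> Z = 0) \<longleftrightarrow> (\<forall>b\<in>P. b \<bullet> Z = 0)" for Z
  proof
    assume a: "\<forall>b\<in>S. b \<bullet> Z = 0"
    have "subspace {b. b \<bullet> Z = 0}" by (auto simp: subspace_def inner_left_distrib)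
    with a show "\<forall>b\<in>P. b \<bullet> Z = 0"
      unfolding P_def using span_minimal[of S "{b. b \<bullet> Z = 0}"] by blast
  qed (auto simp: P_def span_base)
  \<comment> \<open>\<open>P\<close> is its own double orthogonal complement, so membership can be
    tested on the matrices orthogonal to \<open>P\<close>, which form the subalgebra.\<close>
  have inP: "V \<in> P" if "\<And>Z. (\<forall>b\<in>P. b \<bullet> Z = 0) \<Longrightarrow> Z \<bullet> V = 0" for V
  proof -
    have "V \<in> P\<^sup>\<bottom>\<^sup>\<bottom>"
      using that by (auto simp: orthogonal_comp_def orthogonal_def inner_commute)
    then show ?thesis using orthogonal_comp_self[OF sP] by simp
  qed
  \<comment> \<open>This matrix is the adjoint of bracketing with \<open>outer u w\<close>, applied
    to \<open>Y\<close>. As that bracket preserves the subalgebra, its adjoint preserves the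
    orthogonal complement \<open>P\<close>.\<close>
  have V: "outer w (transpose Y *v u) - outer (Y *v w) u \<in> P"
    if w: "\<forall>b\<in>P. b \<bullet> outer u w = 0" and Y: "Y \<in> P" for u w Y
  proof (rule inP)
    fix Z assume Z: "\<forall>b\<in>P. b \<bullet> Z = 0"
    have "\<forall>b\<in>S. b \<bullet> (outer u w ** Z - Z ** outer u w) = 0"
    proof
      fix b assume "b \<in> S"
      then show "b \<bullet> (outer u w ** Z - Z ** outer u w) = 0"
        by (rule bracket[rotated 2]) (simp_all add: w Z SP)
    qed
    then have "Y \<bullet> (outer u w ** Z - Z ** outer u w) = 0" using perp Y by blast
    then have "(outer u w ** Z) \<bullet> Y - (Z ** outer u w) \<bullet> Y = 0"
      by (simp add: inner_diff_right inner_commute)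
    moreover have "(outer u w ** Z) \<bullet> Y = Z \<bullet> outer w (transpose Y *v u)"
      unfolding inner_transpose_mult by (simp only: transpose_outer outer_mult_left)
    moreover have "(Z ** outer u w) \<bullet> Y = Z \<bullet> outer (Y *v w) u"
      unfolding inner_mult_transpose by (simp only: transpose_outer outer_mult_right)
    ultimately show "Z \<bullet> (outer w (transpose Y *v u) - outer (Y *v w) u) = 0"
      by (simp only: inner_diff_right)
  qed
  have "transpose Y *v u \<in> span {u}" if Y: "Y \<in> P" for Y u
  proof (rule ccontr)
    assume n: "transpose Y *v u \<notin> span {u}"
    let ?T = "\<lambda>Y. transpose Y *v u"
    have linT: "linear ?T"
      by (auto simp: linear_iff vec_eq_iff transpose_def matrix_vector_mult_def sum.distrib
          distrib_left sum_distrib_left mult_ac)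
    let ?Q = "?T ` P"
    let ?V = "\<lambda>w. outer w (transpose Y *v u) - outer (Y *v w) u"
    have linV: "linear ?V"
      by (auto simp: linear_iff vec_eq_iff matrix_vector_mult_def sum.distrib algebra_simps sum_distrib_left)
    have sQ: "subspace ?Q" using linT sP by (rule linear_subspace_image)
    define W where "W = {w. \<forall>q\<in>?Q. orthogonal q w}"
    have sW: "subspace W" unfolding W_def by (auto simp: subspace_def orthogonal_clauses)
    have W: "\<forall>b\<in>P. b \<bullet> outer u w = 0" if "w \<in> W" for w
      using that by (auto simp: W_def orthogonal_def inner_commute[of _ "outer _ _"] inner_outer' inner_commute[of w])
    have dW: "dim ?Q + dim W = CARD('m)"
      using dim_subspace_orthogonal_to_vectors[of ?Q UNIV] sQ
      by (simp add: W_def add.commute orthogonal_commute)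
    \<comment> \<open>The component of \<open>transpose Y *v u\<close> perpendicular to
      \<open>u\<close>. Applying \<open>?V w\<close> to it leaves a nonzero multiple of
      \<open>w\<close>, which makes \<open>?V\<close> injective.\<close>
    obtain z where z: "z \<bullet> u = 0" "z \<bullet> (transpose Y *v u) \<noteq> 0"
    proof -
      obtain z where "z \<in> span {u}" "\<And>y. y \<in> span {u} \<Longrightarrow> orthogonal (transpose Y *v u - z) y"
        using orthogonal_subspace_decomp_exists[of "{u}" "transpose Y *v u"] 
        by (metis add_diff_cancel_left')
      then have o: "orthogonal (transpose Y *v u - z) u" "orthogonal (transpose Y *v u - z) z"
        and "z \<noteq> transpose Y *v u" using n by (auto simp: span_base)
      have "(transpose Y *v u - z) \<bullet> (transpose Y *v u) = (transpose Y *v u - z) \<bullet> (transpose Y *v u - z)"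
        using o(2) by (simp add: orthogonal_def inner_diff_right)
      also have "\<dots> \<noteq> 0" using \<open>z \<noteq> transpose Y *v u\<close> by simp
      finally show ?thesis using o(1) that by (auto simp: orthogonal_def)
    qed
    have "inj_on ?V W"
    proof (rule inj_onI)
      fix w w' assume "?V w = ?V w'"
      then have "?V w *v z = ?V w' *v z" by simp
      then have "(z \<bullet> (transpose Y *v u)) *\<^sub>R w = (z \<bullet> (transpose Y *v u)) *\<^sub>R w'"
        by (simp add: outer_mult_vec matrix_vector_mult_diff_rdistrib inner_commute[of _ z] z)
      then show "w = w'" using z by simp
    qed
    then have "dim (?V ` W) = dim W"
      using dim_image_eq[OF linV, of W] span_eq_iff[THEN iffD2, OF sW] by argo
    moreover have "dim ?Q + dim (?V ` W) \<le> dim P"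
    proof (rule dim_eq_image_kernel_le[OF linT sP])
      show "?V ` W \<subseteq> P" using V W Y by blast
      show "subspace (?V ` W)" using linV sW by (rule linear_subspace_image)
      fix x assume "x \<in> ?V ` W"
      then obtain w where w: "w \<in> W" "x = ?V w" by blast
      \<comment> \<open>Up to sign, \<open>?T (?V w)\<close> combines
        \<open>transpose Y *v u\<close> and \<open>u\<close> with the coefficients
        \<open>w \<bullet> u\<close> and \<open>(Y *v w) \<bullet> u\<close>. Both vanish because
        \<open>mat 1\<close> and \<open>Y\<close> lie in \<open>P\<close>; this is where the scalars
        enter.\<close>
      have "mat 1 \<bullet> outer u w = 0" using W w PI by blast
      then have 1: "w \<bullet> u = 0" by (simp add: trace_eq_inner[symmetric] trace_outer inner_commute)
      have "Y \<bullet> outer u w = 0" using W w Y by blast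
      then have 2: "(Y *v w) \<bullet> u = 0" by (metis inner_commute inner_outer)
      show "?T x = 0"
        unfolding w(2) linear_diff[OF linT] transpose_outer outer_mult_vec 1 2 by simp
    qed
    ultimately show False using dW dP by linarith
  qed
  then have "b \<in> span {mat 1}"
    using scalar_matrixI[of b] SP[OF b] by blast
  then show ?thesis
    using X by (auto simp: span_singleton trace_eq_inner)
qed

section \<open>Approximate homomorphisms on transvections\<close>

definition unit_matrix :: "'m \<Rightarrow> 'm \<Rightarrow> real^'m^'m" where
  "unit_matrix i j = outer (axis i 1) (axis j 1)"

definition transvection :: "'m \<Rightarrow> 'm \<Rightarrow> real \<Rightarrow> real^'m^'m" where
  "transvection i j s = mat 1 + s *\<^sub>R unit_matrix i j"

lemma outer_mult_outer: "outer u w ** outer u' w' = (w \<bullet> u') *\<^sub>R outer u w'"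
  by (simp add: vec_eq_iff matrix_matrix_mult_def inner_vec_def sum_distrib_left sum_distrib_right mult_ac)

lemma unit_matrix_mult:
  "unit_matrix i j ** unit_matrix k l = (if j = k then unit_matrix i l else 0)"
  by (simp add: unit_matrix_def outer_mult_outer inner_axis_axis)

lemma norm_unit_matrix: "norm (unit_matrix i j) = 1"
proof -
  have "norm (unit_matrix i j) ^ 2 = 1"
    unfolding power2_norm_eq_inner unit_matrix_def inner_outer outer_mult_vec
    by (simp add: inner_axis_axis)
  then show ?thesis by (simp add: power2_eq_1_iff) (metis norm_ge_zero not_numeral_le_zero neg_0_le_iff_le not_one_le_zero order_antisym)
qed

lemma norm_transvection: "norm (transvection i j s - mat 1) = \<bar>s\<bar>"
  by (simp add: transvection_def norm_unit_matrix)

lemma transvection_0 [simp]: "transvection i j 0 = mat 1"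
  by (simp add: transvection_def)

lemma transvection_add:
  "i \<noteq> j \<Longrightarrow> transvection i j s ** transvection i j t = transvection i j (s + t)"
  by (simp add: transvection_def matrix_mult_simps unit_matrix_mult scaleR_add_left algebra_simps)

text \<open>The diagonalizable \<open>D\<close> doubling \<open>u w\<^sup>T\<close> conjugates \<open>1 + u w\<^sup>T\<close> to its square.\<close>

lemma det_outer:
  assumes "u \<bullet> w = 0" shows "det (mat 1 + outer u w) = 1"
proof (cases "u = 0")
  case True
  then have "outer u w = 0" by (simp add: vec_eq_iff)
  then show ?thesis by simp
next
  case False
  let ?X = "outer u w" and ?c = "1 / (u \<bullet> u)"
  \<comment> \<open>\<open>?c *\<^sub>R outer u u\<close> is the orthogonal projection onto the line
    of \<open>u\<close>, so \<open>?D\<close> doubles \<open>u\<close> and fixes the orthogonal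
    complement, which contains \<open>w\<close>; \<open>?D'\<close> is its inverse.\<close>
  let ?D = "mat 1 + ?c *\<^sub>R outer u u" and ?D' = "mat 1 - (?c / 2) *\<^sub>R outer u u"
  have uu: "u \<bullet> u \<noteq> 0" using False by simp
  have "?D ** ?D' = mat 1 + (?c - ?c / 2 - ?c * (?c / 2) * (u \<bullet> u)) *\<^sub>R outer u u"
    by (simp only: matrix_mult_simps outer_mult_outer matrix_mul_lid matrix_mul_rid)
      (simp add: vec_eq_iff algebra_simps)
  also have "?c - ?c / 2 - ?c * (?c / 2) * (u \<bullet> u) = 0" using uu by (simp add: field_simps)
  finally have "?D ** ?D' = mat 1" by simp
  then have "det ?D \<noteq> 0" by (metis det_I det_mul mult_zero_left zero_neq_one)
  moreover have XX: "?X ** ?X = 0" and XD: "?X ** outer u u = 0" and DX: "outer u u ** ?X = (u \<bullet> u) *\<^sub>R ?X"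
    using assms by (simp_all add: outer_mult_outer inner_commute[of w])
  have "?D ** (mat 1 + ?X) = (mat 1 + (?X + ?X)) ** ?D"
    unfolding matrix_mult_simps matrix_mul_lid matrix_mul_rid XX XD DX
    using uu by (simp add: vec_eq_iff)
  moreover have "mat 1 + (?X + ?X) = (mat 1 + ?X) ** (mat 1 + ?X)"
    unfolding matrix_mult_simps matrix_mul_lid matrix_mul_rid XX by simp
  ultimately have "det (mat 1 + ?X) = det (mat 1 + ?X) * det (mat 1 + ?X)"
    by (metis det_mul mult.commute mult_cancel_right)
  moreover have "(mat 1 + ?X) ** (mat 1 - ?X) = mat 1"
    unfolding matrix_mult_simps matrix_mul_lid matrix_mul_rid XX by simp
  then have "det (mat 1 + ?X) \<noteq> 0" by (metis det_I det_mul mult_zero_left zero_neq_one)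
  ultimately show ?thesis by (metis mult_cancel_right1)
qed

lemma outer_scaleR: "outer (c *\<^sub>R u) w = c *\<^sub>R outer u w"
  by (simp add: vec_eq_iff)

lemma det_transvection: "i \<noteq> j \<Longrightarrow> det (transvection i j s) = 1"
  using det_outer[of "s *\<^sub>R axis i 1" "axis j 1"]
  by (simp add: transvection_def unit_matrix_def outer_scaleR inner_axis_axis)

lemma near_mat_1_mult:
  fixes \<delta> :: real assumes "\<delta> > 0"
  obtains \<delta>' where "\<delta>' > 0" "\<delta>' \<le> \<delta>"
    "\<And>g h :: real^'m^'m. norm (g - mat 1) < \<delta>' \<Longrightarrow> norm (h - mat 1) < \<delta>' \<Longrightarrow> norm (g ** h - mat 1) < \<delta>"
proof -
  have "((\<lambda>z. fst z ** snd z) \<longlongrightarrow> mat 1 ** mat 1) (nhds (mat 1 :: real^'m^'m) \<times>\<^sub>F nhds (mat 1 :: real^'m^'m))"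
    by (intro tendsto_matrix_mult filterlim_fst filterlim_snd)
  then have "\<forall>\<^sub>F z in nhds (mat 1 :: real^'m^'m) \<times>\<^sub>F nhds (mat 1 :: real^'m^'m). dist (fst z ** snd z) (mat 1) < \<delta>"
    using assms by (auto dest: tendstoD)
  then obtain P Q where P: "eventually P (nhds (mat 1 :: real^'m^'m))" "eventually Q (nhds (mat 1 :: real^'m^'m))"
    "\<And>g h. P g \<Longrightarrow> Q h \<Longrightarrow> dist (g ** h) (mat 1) < \<delta>"
    unfolding eventually_prod_filter by auto
  obtain d where d: "d > 0" "\<And>g. dist g (mat 1) < d \<Longrightarrow> P g \<and> Q g"
    using eventually_conj[OF P(1,2)] unfolding eventually_nhds_metric by blast
  show ?thesis
    by (rule that[of "min d \<delta>"]) (use d P(3) assms in \<open>auto simp: dist_norm\<close>)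
qed

text \<open>The two middle factors multiply to the block with rows \<open>a\<close>,
  \<open>r\<close> and \<open>r\<close>, \<open>1\<close>. The outer factors are the row and column
  operations that clear both entries \<open>r\<close> against the pivot \<open>a\<close>; as the
  determinant is one, \<open>a\<close> and \<open>1 / a\<close> are left on the diagonal. For small
  \<open>r\<close> all factors are near the identity.\<close>

lemma diagonal_as_transvections:
  fixes r :: real assumes "i \<noteq> j" defines "a \<equiv> 1 + r\<^sup>2"
  shows "(transvection j i (- r / a) ** transvection i j r) ** (transvection j i r ** transvection i j (- r / a))
      = mat 1 + (a - 1) *\<^sub>R unit_matrix i i + (1 / a - 1) *\<^sub>R unit_matrix j j"
proof -
  have a: "a \<noteq> 0" unfolding a_def using zero_le_power2[of r] by linarith
  have r: "r\<^sup>2 = a - 1" by (simp add: a_def)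
  have ra: "r * r = a - 1" using r by (simp add: power2_eq_square)
  have "(transvection j i (- r / a) ** transvection i j r) ** (transvection j i r ** transvection i j (- r / a))
    = mat 1 + (r * r) *\<^sub>R unit_matrix i i + (r - r / a - r * (r * r) / a) *\<^sub>R unit_matrix i j
      + (r - r / a - r * (r * r) / a) *\<^sub>R unit_matrix j i
      + (r * r * (r * r) / (a * a) - 2 * (r * r) / a + r*r/(a*a)) *\<^sub>R unit_matrix j j"
    using assms(1)
    by (simp add: transvection_def matrix_mult_simps unit_matrix_mult vec_eq_iff algebra_simps add_divide_distrib)
  also have "r - r / a - r * (r * r) / a = 0"
    unfolding ra using a by (simp add: field_simps)
  also have "r * r * (r * r) / (a * a) - 2 * (r * r) / a + r*r/(a*a) = 1 / a - 1"
    unfolding ra using a by (simp add: field_simps)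
  finally show ?thesis by (simp add: ra)
qed

lemma diagonal_conj_transvection:
  fixes a :: real assumes "i \<noteq> j" "a \<noteq> 0"
    and "d = mat 1 + (a - 1) *\<^sub>R unit_matrix i i + (1 / a - 1) *\<^sub>R unit_matrix j j"
  shows "d ** transvection i j v = transvection i j (a\<^sup>2 * v) ** d"
  using assms(1,2) unfolding assms(3)
  by (simp add: transvection_def matrix_mult_simps unit_matrix_mult, simp add: vec_eq_iff field_simps power2_eq_square)

text \<open>The error is measured by the factor that acts first: for a displacement
  \<open>f g = F (g, y) - y\<close> the defect compares the displacements under \<open>g\<close> of
  two points that differ by \<open>f h\<close>, so a derivative bound controls it. \<open>H\<close>
  is closed only under products near the identity, as in a local group.\<close>

definition approximate_hom :: "real \<Rightarrow> (real^'m^'m) set \<Rightarrow> (real^'m^'m \<Rightarrow> 'v::real_normed_vector) \<Rightarrow> real \<Rightarrow> bool" where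
  "approximate_hom \<delta> H f \<epsilon> \<longleftrightarrow>
     (\<forall>g\<in>H. \<forall>h\<in>H. norm (g ** h - mat 1) < \<delta> \<longrightarrow> g ** h \<in> H) \<and>
     (\<forall>g\<in>H. \<forall>h\<in>H. g ** h \<in> H \<longrightarrow> norm (f (g ** h) - f g - f h) \<le> \<epsilon> * norm (f h))"

text \<open>Thurston's stability argument, for a function \<open>f\<close> that is a local homomorphism up to a small
  relative error. If \<open>d\<close> is the diagonal matrix with entries \<open>a\<close> and \<open>1 / a\<close>, written as a product of
  transvections, then \<open>d E(v) = E(a\<^sup>2 v) d\<close>; the contribution of \<open>d\<close> cancels, and \<open>f (E ((a\<^sup>2 - 1) v))\<close>
  is small. Exact homomorphisms are the case \<open>\<epsilon> = 0\<close>.\<close>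

lemma approximate_hom_transvection:
  fixes \<delta> :: real assumes "\<delta> > 0"
  shows "\<exists>r K. 0 < r \<and> r < \<delta> \<and> 0 \<le> K \<and>
    (\<forall>(i::'m::finite) j H (f :: real^'m^'m \<Rightarrow> 'v::real_normed_vector) \<epsilon> m s.
      i \<noteq> j \<longrightarrow> \<bar>s\<bar> \<le> r \<longrightarrow> 0 \<le> \<epsilon> \<longrightarrow> \<epsilon> \<le> 1 \<longrightarrow> approximate_hom \<delta> H f \<epsilon> \<longrightarrow>
      (\<forall>t. \<bar>t\<bar> \<le> r \<longrightarrow> transvection i j t \<in> H \<and> transvection j i t \<in> H) \<longrightarrow>
      (\<forall>t. \<bar>t\<bar> \<le> r \<longrightarrow> norm (f (transvection i j t)) \<le> m \<and> norm (f (transvection j i t)) \<le> m) \<longrightarrow>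
      norm (f (transvection i j s)) \<le> K * \<epsilon> * m)"
proof -
  \<comment> \<open>One radius per level of the product: \<open>d3\<close> for transvections,
    \<open>d2\<close> for the two halves of the diagonal matrix, \<open>d1\<close> for that matrix,
    \<open>\<delta>\<close> for its product with a further transvection. The resulting
    \<open>r\<close> and \<open>12 * real N\<close> depend neither on \<open>f\<close> nor on
    \<open>H\<close>, which allows the estimate to be iterated.\<close>
  obtain d1 where d1: "d1 > 0" "d1 \<le> \<delta>"
    "\<And>g h :: real^'m^'m. norm (g - mat 1) < d1 \<Longrightarrow> norm (h - mat 1) < d1 \<Longrightarrow> norm (g ** h - mat 1) < \<delta>"
    using near_mat_1_mult[OF assms] by metis
  obtain d2 where d2: "d2 > 0" "d2 \<le> d1"
    "\<And>g h :: real^'m^'m. norm (g - mat 1) < d2 \<Longrightarrow> norm (h - mat 1) < d2 \<Longrightarrow> norm (g ** h - mat 1) < d1"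
    using near_mat_1_mult[OF d1(1)] by metis
  obtain d3 where d3: "d3 > 0" "d3 \<le> d2"
    "\<And>g h :: real^'m^'m. norm (g - mat 1) < d3 \<Longrightarrow> norm (h - mat 1) < d3 \<Longrightarrow> norm (g ** h - mat 1) < d2"
    using near_mat_1_mult[OF d2(1)] by metis
  define r where "r = min (d3 / 2) (1 / 2)"
  have r: "r > 0" "r < d3" "r \<le> 1 / 2" using d3(1) by (auto simp: r_def)
  define a where "a = 1 + r\<^sup>2"
  have "r\<^sup>2 \<le> (1/2)\<^sup>2" using r by (intro power_mono) auto
  then have a: "1 < a" "a \<le> 5/4" using r(1) by (auto simp: a_def power2_eq_square)
  have a2: "1 < a\<^sup>2" "a\<^sup>2 \<le> 2"
  proof -
    show "1 < a\<^sup>2" using a(1) by (simp add: one_less_power)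
    have "a\<^sup>2 \<le> (5/4)\<^sup>2" using a by (intro power_mono) auto
    then show "a\<^sup>2 \<le> 2" by (simp add: power2_eq_square)
  qed
  \<comment> \<open>An increment of size at most \<open>q\<close> equals
    \<open>(a\<^sup>2 - 1) * v\<close> with \<open>v\<close> of size at most \<open>r / 2\<close>;
    since \<open>a\<^sup>2 \<le> 2\<close>, the conjugate parameter \<open>a\<^sup>2 * v\<close> is
    still at most \<open>r\<close>. \<open>N\<close> such increments reach \<open>r\<close>.\<close>
  define q where "q = (a\<^sup>2 - 1) * r / 2"
  have q: "q > 0" using a2 r by (simp add: q_def)
  obtain N :: nat where N: "r \<le> real N * q" using q reals_Archimedean3 by (metis less_imp_le)
  have "N > 0" using N r q by (cases N) auto
  show ?thesis
  proof (rule exI[of _ r], rule exI[of _ "12 * real N"], intro conjI allI impI)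
    show "r > 0" by fact
    show "r < \<delta>" using r d1 d2 d3 by linarith
    show "12 * real N \<ge> 0" by simp
    fix i j :: 'm and H and f :: "real^'m^'m \<Rightarrow> 'v" and \<epsilon> m s :: real
    assume ij: "i \<noteq> j" and s: "\<bar>s\<bar> \<le> r" and e: "0 \<le> \<epsilon>" "\<epsilon> \<le> 1" and ah: "approximate_hom \<delta> H f \<epsilon>"
      and H': "\<forall>t. \<bar>t\<bar> \<le> r \<longrightarrow> transvection i j t \<in> H \<and> transvection j i t \<in> H"
      and m': "\<forall>t. \<bar>t\<bar> \<le> r \<longrightarrow> norm (f (transvection i j t)) \<le> m \<and> norm (f (transvection j i t)) \<le> m"
    note H = H'[rule_format] and m = m'[rule_format]
    have mult: "\<And>g h. g \<in> H \<Longrightarrow> h \<in> H \<Longrightarrow> norm (g ** h - mat 1) < \<delta> \<Longrightarrow> g ** h \<in> H"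
      and hom: "\<And>g h. g \<in> H \<Longrightarrow> h \<in> H \<Longrightarrow> g ** h \<in> H \<Longrightarrow> norm (f (g ** h) - f g - f h) \<le> \<epsilon> * norm (f h)"
      using ah unfolding approximate_hom_def by blast+
    let ?E = "transvection i j" and ?F = "transvection j i"
    have "norm (f (?E 0)) \<le> m" using m[of 0] r by simp
    then have m0: "m \<ge> 0" using norm_ge_zero order_trans by blast
    have em: "\<epsilon> * x \<le> \<epsilon> * m" if "x \<le> m" for x using that e by (simp add: mult_left_mono)
    have bnd: "norm (f (g ** h)) \<le> norm (f g) + 2 * norm (f h)" if "g \<in> H" "h \<in> H" "g ** h \<in> H" for g h
    proof -
      have "norm (f (g ** h)) \<le> norm (f g) + norm (f h) + norm (f (g ** h) - f g - f h)"
        using norm_triangle_ineq[of "f g + f h" "f (g ** h) - f g - f h"] norm_triangle_ineq[of "f g" "f h"]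
        by simp
      moreover have "\<epsilon> * norm (f h) \<le> 1 * norm (f h)" using e by (intro mult_right_mono) auto
      ultimately show ?thesis using hom[OF that] by linarith
    qed
    have ra: "\<bar>- r / a\<bar> \<le> r" using r a by (simp add: field_simps)
    have sm: "norm (?E t - mat 1) < d3" "norm (?F t - mat 1) < d3" if "\<bar>t\<bar> \<le> r" for t
      using that r by (simp_all add: norm_transvection)
    define g1 where "g1 = ?F (- r / a) ** ?E r"
    define g2 where "g2 = ?F r ** ?E (- r / a)"
    define d where "d = g1 ** g2"
    have n1: "norm (g1 - mat 1) < d2" "norm (g2 - mat 1) < d2"
      unfolding g1_def g2_def using sm ra r by (auto intro!: d3(3))
    have nd: "norm (d - mat 1) < d1" unfolding d_def using n1 by (intro d2(3))
    have g: "g1 \<in> H" "g2 \<in> H"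
      using n1 d1 d2 H ra r unfolding g1_def g2_def by (auto intro!: mult)
    have dH: "d \<in> H" using nd d1 g unfolding d_def by (auto intro!: mult)
    \<comment> \<open>Each product costs a factor of three through \<open>bnd\<close>:
      \<open>m + 2 * m\<close> for the halves, then \<open>3 * m + 6 * m\<close> for
      \<open>d\<close>.\<close>
    have "norm (f g1) \<le> 3 * m" "norm (f g2) \<le> 3 * m"
      using bnd[of "?F (- r / a)" "?E r"] bnd[of "?F r" "?E (- r / a)"] m[OF ra] m[of r] H ra r g
      unfolding g1_def g2_def by fastforce+
    then have fd: "norm (f d) \<le> 9 * m"
      using bnd[of g1 g2] g dH unfolding d_def by linarith
    have dE: "d ** ?E v = ?E (a\<^sup>2 * v) ** d" for v
      using diagonal_conj_transvection[OF ij, of a d v] diagonal_as_transvections[OF ij, of r] a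
      unfolding d_def g1_def g2_def a_def by simp
    \<comment> \<open>The constant is \<open>1 + 9 + 1\<close>, from the defects of
      \<open>d ** ?E v\<close>, \<open>?E (a\<^sup>2 * v) ** d\<close> and
      \<open>?E t ** ?E v\<close>, measured by \<open>?E v\<close>, \<open>d\<close> and
      \<open>?E v\<close>.\<close>
    have small: "norm (f (?E t)) \<le> 11 * (\<epsilon> * m)" if t: "\<bar>t\<bar> \<le> q" for t
    proof -
      define v where "v = t / (a\<^sup>2 - 1)"
      have v: "\<bar>v\<bar> \<le> r / 2" using t a2 by (simp add: v_def q_def field_simps)
      have av: "\<bar>a\<^sup>2 * v\<bar> \<le> r"
      proof -
        have "a\<^sup>2 * \<bar>v\<bar> \<le> 2 * (r / 2)" using v a2 r by (intro mult_mono) auto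
        then show ?thesis by (simp add: abs_mult)
      qed
      have tv: "t + v = a\<^sup>2 * v" using a2 by (simp add: v_def field_simps)
      have tr: "\<bar>t\<bar> \<le> r"
      proof -
        have "(a\<^sup>2 - 1) * r \<le> 1 * r" using a2 r by (intro mult_right_mono) auto
        then show ?thesis using t r unfolding q_def by linarith
      qed
      have vr: "\<bar>v\<bar> \<le> r" using v r by linarith
      have "d ** ?E v \<in> H"
        by (rule mult) (use dH H[OF vr] d1(3)[OF nd] sm[OF vr] d2 d3 in \<open>auto intro: less_le_trans\<close>)
      note c = hom[OF dH _ this] hom[OF _ dH, of "?E (a\<^sup>2 * v)", folded dE, OF _ this]
      have 1: "norm (f (d ** ?E v) - f d - f (?E v)) \<le> \<epsilon> * m"
        using c(1) H[OF vr] em m[OF vr] by fastforce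
      have "\<epsilon> * norm (f d) \<le> \<epsilon> * (9 * m)" using fd e by (intro mult_left_mono)
      then have 2: "norm (f (d ** ?E v) - f (?E (a\<^sup>2 * v)) - f d) \<le> 9 * (\<epsilon> * m)"
        using c(2) H[OF av] by fastforce
      have eq: "f (?E (a\<^sup>2 * v)) - f (?E v) = (f (d ** ?E v) - f d - f (?E v)) - (f (d ** ?E v) - f (?E (a\<^sup>2 * v)) - f d)"
        by simp
      have 3: "norm (f (?E (a\<^sup>2 * v)) - f (?E v)) \<le> 10 * (\<epsilon> * m)"
        unfolding eq using 1 2 norm_triangle_ineq4[of "f (d ** ?E v) - f d - f (?E v)" "f (d ** ?E v) - f (?E (a\<^sup>2 * v)) - f d"]
        by linarith
      have "norm (f (?E (a\<^sup>2 * v)) - f (?E t) - f (?E v)) \<le> \<epsilon> * m"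
        using hom[of "?E t" "?E v"] H[OF tr] H[OF vr] H[OF av] em m[OF vr] 
        by (fastforce simp: transvection_add[OF ij] tv)
      then show ?thesis
        using 3 norm_triangle_ineq4[of "f (?E (a\<^sup>2 * v)) - f (?E v)" "f (?E (a\<^sup>2 * v)) - f (?E t) - f (?E v)"]
        by simp
    qed
    define t where "t = s / real N"
    have t: "\<bar>t\<bar> \<le> q" using s N \<open>N > 0\<close> by (simp add: t_def field_simps)
    \<comment> \<open>In units of \<open>\<epsilon> * m\<close>, each increment contributes
      \<open>11\<close> and the defect of its product \<open>1\<close>.\<close>
    have "norm (f (?E (real k * t))) \<le> real k * (12 * (\<epsilon> * m))" if "k \<le> N" "k \<ge> 1" for k
      using that(2,1)
    proof (induction k rule: dec_induct)
      case base
      have "0 \<le> \<epsilon> * m" using e m0 by simp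
      then show ?case using small[OF t] by simp
    next
      case (step k)
      have le: "\<bar>real l * t\<bar> \<le> r" if "l \<le> N" for l
      proof -
        have "real l * \<bar>t\<bar> \<le> real N * \<bar>t\<bar>" using that by (intro mult_right_mono) auto
        also have "\<dots> = \<bar>s\<bar>" using \<open>N > 0\<close> by (simp add: t_def)
        finally show ?thesis using s by (simp add: abs_mult)
      qed
      have H3: "?E (real k * t) \<in> H" "?E t \<in> H" "?E (real k * t + t) \<in> H" "norm (f (?E t)) \<le> m"
        using le[of k] le[of 1] le[of "Suc k"] step H m by (auto simp: algebra_simps)
      have "norm (f (?E (real k * t + t)) - f (?E (real k * t)) - f (?E t)) \<le> \<epsilon> * m"
        using hom[of "?E (real k * t)" "?E t"] H3 em by (fastforce simp: transvection_add[OF ij])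
      then have "norm (f (?E (real k * t + t))) \<le> norm (f (?E (real k * t))) + norm (f (?E t)) + \<epsilon> * m"
        using norm_triangle_ineq[of "f (?E (real k * t)) + f (?E t)" "f (?E (real k * t + t)) - f (?E (real k * t)) - f (?E t)"]
          norm_triangle_ineq[of "f (?E (real k * t))" "f (?E t)"] by simp
      also have "\<dots> \<le> real (Suc k) * (12 * (\<epsilon> * m))"
        using step small[OF t] by (simp add: algebra_simps)
      finally show ?case by (simp add: algebra_simps)
    qed
    from this[of N] show "norm (f (?E s)) \<le> 12 * real N * \<epsilon> * m"
      using \<open>N > 0\<close> by (simp add: t_def mult_ac)
  qed
qed

section \<open>Local actions in a chart\<close>

text \<open>Even at a boundary point the half-space contains a short segment in every positive
  coordinate direction, and these directions determine a linear map.\<close>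

lemma has_derivative_unique_half_space:
  fixes k :: "'n::finite" and y :: "real^'n"
  assumes "(f has_derivative f') (at y within half_space k)" "(f has_derivative f'') (at y within half_space k)"
    and "y \<in> half_space k"
  shows "f' = f''"
proof (rule frechet_derivative_unique_within[OF assms(1,2)])
  fix i :: "real^'n" and e :: real assume i: "i \<in> Basis" "e > 0"
  have "i $ k \<ge> 0" using i(1) by (auto simp: Basis_vec_def axis_def)
  then have "y + (e / 2) *\<^sub>R i \<in> half_space k"
    using assms(3) i(2) by (simp add: half_space_def)
  then show "\<exists>d. 0 < \<bar>d\<bar> \<and> \<bar>d\<bar> < e \<and> y + d *\<^sub>R i \<in> half_space k"
    using i(2) by (intro exI[of _ "e / 2"]) auto
qed

text \<open>The action in a chart near a point \<open>p\<close>: \<open>F\<close> is a \<open>C\<^sup>1\<close> extension of \<open>(g, y) \<mapsto> g y\<close> beyond the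
  half-space and beyond the group.\<close>

locale local_SL_action =
  fixes k :: "'n::finite" and p :: "real^'n"
    and F :: "(real^'m^'m) \<times> (real^'n) \<Rightarrow> real^'n"
    and F' :: "(real^'m^'m) \<times> (real^'n) \<Rightarrow> ((real^'m^'m) \<times> (real^'n)) \<Rightarrow>\<^sub>L (real^'n)"
    and \<delta> e :: real
  assumes dim: "CARD('m::finite) = CARD('n) + 1"
    and \<delta>: "\<delta> > 0" and e: "e > 0" and p: "p \<in> half_space k"
    and deriv: "norm (g - mat 1) < \<delta> \<Longrightarrow> norm (y - p) < e \<Longrightarrow>
      (F has_derivative blinfun_apply (F' (g, y))) (at (g, y))"
    and cont: "continuous_on {(g, y). norm (g - mat 1) < \<delta> \<and> norm (y - p) < e} F'"
    and half: "det g = 1 \<Longrightarrow> norm (g - mat 1) < \<delta> \<Longrightarrow> y \<in> half_space k \<Longrightarrow> norm (y - p) < e \<Longrightarrow>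
      F (g, y) \<in> half_space k"
    and ident: "y \<in> half_space k \<Longrightarrow> norm (y - p) < e \<Longrightarrow> F (mat 1, y) = y"
    and law: "det g = 1 \<Longrightarrow> det h = 1 \<Longrightarrow> norm (g - mat 1) < \<delta> \<Longrightarrow> norm (h - mat 1) < \<delta> \<Longrightarrow>
      norm (g ** h - mat 1) < \<delta> \<Longrightarrow> y \<in> half_space k \<Longrightarrow> norm (y - p) < e \<Longrightarrow> norm (F (h, y) - p) < e \<Longrightarrow>
      F (g, F (h, y)) = F (g ** h, y)"
begin

section \<open>Orbit curves and their velocities\<close>

definition B :: "(real^'m^'m) set" where "B = {g. det g = 1 \<and> norm (g - mat 1) < \<delta>}"

definition C :: "(real^'n) set" where "C = {y \<in> half_space k. norm (y - p) < e}"

text \<open>The derivative at the identity of the orbit map of \<open>y\<close>. Only trace zero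
  matrices are tangent to the group; on others the value depends on the chosen extension
  \<open>F\<close>, whence the trace conditions below.\<close>

definition \<rho> :: "real^'n \<Rightarrow> real^'m^'m \<Rightarrow> real^'n" where "\<rho> y X = blinfun_apply (F' (mat 1, y)) (X, 0)"

definition D :: "real^'m^'m \<Rightarrow> real^'n \<Rightarrow> real^'n \<Rightarrow> real^'n" where
  "D g y v = blinfun_apply (F' (g, y)) (0, v)"

lemma mat_1_B [simp]: "mat 1 \<in> B" using \<delta> by (simp add: B_def)

lemma p_C [simp]: "p \<in> C" using e p by (simp add: C_def)

lemma F_1 [simp]: "y \<in> C \<Longrightarrow> F (mat 1, y) = y" using ident by (simp add: C_def)

lemma F_half: "g \<in> B \<Longrightarrow> y \<in> C \<Longrightarrow> F (g, y) \<in> half_space k" using half by (simp add: B_def C_def)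

lemma F_mult: "g \<in> B \<Longrightarrow> h \<in> B \<Longrightarrow> g ** h \<in> B \<Longrightarrow> y \<in> C \<Longrightarrow> F (h, y) \<in> C \<Longrightarrow> F (g, F (h, y)) = F (g ** h, y)"
  using law by (simp add: B_def C_def)

lemma F_has_derivative: "g \<in> B \<Longrightarrow> y \<in> C \<Longrightarrow> (F has_derivative blinfun_apply (F' (g, y))) (at (g, y))"
  using deriv by (simp add: B_def C_def)

lemma linear_\<rho>: "linear (\<rho> y)"
  unfolding \<rho>_def using blinfun.bounded_linear_right[of "F' (mat 1, y)"]
  by (auto simp: linear_iff blinfun.add_right[symmetric] blinfun.scaleR_right[symmetric])

lemma linear_D: "linear (D g y)"
  unfolding D_def
  by (auto simp: linear_iff blinfun.add_right[symmetric] blinfun.scaleR_right[symmetric])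

lemma tendsto_F:
  assumes "g \<in> B" "y \<in> C" "(a \<longlongrightarrow> g) G" "(b \<longlongrightarrow> y) G"
  shows "((\<lambda>s. F (a s, b s)) \<longlongrightarrow> F (g, y)) G"
  using isCont_tendsto_compose[OF has_derivative_continuous[OF F_has_derivative[OF assms(1,2)]]
      tendsto_Pair[OF assms(3,4)]] .

lemma eventually_B:
  assumes "(a \<longlongrightarrow> g) G" "g \<in> B" "\<forall>\<^sub>F s in G. det (a s) = 1"
  shows "\<forall>\<^sub>F s in G. a s \<in> B"
proof -
  have "((\<lambda>s. norm (a s - mat 1)) \<longlongrightarrow> norm (g - mat 1)) G" by (intro tendsto_intros assms)
  then have "\<forall>\<^sub>F s in G. norm (a s - mat 1) < \<delta>"
    by (rule order_tendstoD) (use assms(2) in \<open>simp add: B_def\<close>)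
  with assms(3) show ?thesis by eventually_elim (simp add: B_def)
qed

lemma eventually_F_C:
  assumes "(a \<longlongrightarrow> mat 1) G" "y \<in> C" "\<forall>\<^sub>F s in G. det (a s) = 1"
  shows "\<forall>\<^sub>F s in G. a s \<in> B \<and> F (a s, y) \<in> C"
proof -
  have "((\<lambda>s. norm (F (a s, y) - p)) \<longlongrightarrow> norm (F (mat 1, y) - p)) G"
    by (intro tendsto_intros tendsto_F assms) simp
  then have "\<forall>\<^sub>F s in G. norm (F (a s, y) - p) < e"
    by (rule order_tendstoD) (use assms(2) F_1[OF assms(2)] in \<open>simp add: C_def\<close>)
  moreover have "\<forall>\<^sub>F s in G. a s \<in> B" using assms by (intro eventually_B) auto
  ultimately show ?thesis
    by eventually_elim (use F_half[OF _ assms(2)] in \<open>simp add: C_def\<close>)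
qed

lemma curve_derivative:
  assumes h: "(h has_vector_derivative V) (at t within T)" "h t = mat 1" and y: "y \<in> C"
  shows "((\<lambda>s. F (h s, y)) has_vector_derivative \<rho> y V) (at t within T)"
proof -
  have "((\<lambda>s. (h s, y)) has_derivative (\<lambda>s. (s *\<^sub>R V, 0))) (at t within T)"
    using h(1) by (auto simp: has_vector_derivative_def intro!: derivative_eq_intros)
  from has_derivative_compose[OF this, of F] F_has_derivative[OF mat_1_B y] h(2)
  have "((\<lambda>s. F (h s, y)) has_derivative (\<lambda>s. F' (mat 1, y) (s *\<^sub>R V, 0))) (at t within T)" by simp
  moreover have "F' (mat 1, y) (s *\<^sub>R V, 0) = s *\<^sub>R \<rho> y V" for s
    using linear_cmul[OF linear_\<rho>, of y s V] by (simp add: \<rho>_def)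
  ultimately show ?thesis by (simp add: has_vector_derivative_def)
qed

lemma D_has_derivative:
  assumes "g \<in> B" "y \<in> C" shows "((\<lambda>z. F (g, z)) has_derivative D g y) (at y within T)"
proof -
  have "((\<lambda>z. (g, z)) has_derivative (\<lambda>v. (0, v))) (at y within T)"
    by (auto intro!: derivative_eq_intros)
  from has_derivative_compose[OF this, of F] F_has_derivative[OF assms]
  show ?thesis unfolding D_def by simp
qed

lemma curve_derivative':
  assumes h: "(h has_vector_derivative V) (at t within T)" "h t = mat 1" and y: "y \<in> C" "g \<in> B"
  shows "((\<lambda>s. F (g, F (h s, y))) has_vector_derivative D g y (\<rho> y V)) (at t within T)"
proof -
  have "((\<lambda>z. F (g, z)) has_derivative D g y) (at (F (h t, y)))"
    using D_has_derivative[of g y UNIV] y h(2) by simp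
  from has_derivative_compose[OF curve_derivative[OF h y(1), unfolded has_vector_derivative_def] this]
  show ?thesis by (simp add: has_vector_derivative_def linear_cmul[OF linear_D])
qed

text \<open>Write \<open>\<gamma> s = \<gamma> t ** h s\<close>. By the group law the orbit curve is
  \<open>F (\<gamma> t, F (h s, y))\<close>, with derivative
  \<open>D (\<gamma> t) y (\<rho> y V) = 0\<close> at \<open>t\<close>. Translating on this side
  involves the velocity at \<open>y\<close> only, so uniqueness for differential equations is
  avoided.\<close>

lemma path_fixes:
  assumes y: "y \<in> C" and T: "convex T" "t0 \<in> T" "F (\<gamma> t0, y) = y"
    and \<gamma>: "\<And>t. t \<in> T \<Longrightarrow> \<gamma> t \<in> B"
    and h: "\<And>t. t \<in> T \<Longrightarrow> \<exists>h V. (\<forall>s\<in>T. \<gamma> s = \<gamma> t ** h s \<and> det (h s) = 1) \<and> h t = mat 1 \<and>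
      (h has_vector_derivative V) (at t within T) \<and> \<rho> y V = 0"
    and t: "t \<in> T"
  shows "F (\<gamma> t, y) = y"
proof -
  have "((\<lambda>s. F (\<gamma> s, y)) has_vector_derivative 0) (at t within T)" if t: "t \<in> T" for t
  proof -
    obtain h V where h: "\<And>s. s \<in> T \<Longrightarrow> \<gamma> s = \<gamma> t ** h s \<and> det (h s) = 1" "h t = mat 1"
      "(h has_vector_derivative V) (at t within T)" "\<rho> y V = 0" using h[OF t] by blast
    have der: "((\<lambda>s. F (\<gamma> t, F (h s, y))) has_vector_derivative 0) (at t within T)"
      using curve_derivative'[OF h(3,2) y \<gamma>[OF t]] h(4) linear_0[OF linear_D] by simp
    have "(h \<longlongrightarrow> mat 1) (at t within T)"
      using has_vector_derivative_continuous[OF h(3)] h(2) by (simp add: continuous_within)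
    then have "\<forall>\<^sub>F s in at t within T. h s \<in> B \<and> F (h s, y) \<in> C"
      by (rule eventually_F_C) (use y h(1) in \<open>auto simp: eventually_at_filter\<close>)
    moreover have "F (\<gamma> t, F (h s, y)) = F (\<gamma> s, y)" if "s \<in> T" "h s \<in> B \<and> F (h s, y) \<in> C" for s
      using F_mult[OF \<gamma>[OF t], of "h s" y] h(1)[OF that(1)] \<gamma>[OF that(1)] that y by simp
    ultimately have "\<forall>\<^sub>F s in at t within T. F (\<gamma> t, F (h s, y)) = F (\<gamma> s, y)"
      by (auto elim!: eventually_mono simp: eventually_at_filter)
    then obtain d where d: "d > 0"
      "\<And>s. s \<in> T \<Longrightarrow> s \<noteq> t \<Longrightarrow> dist s t < d \<Longrightarrow> F (\<gamma> t, F (h s, y)) = F (\<gamma> s, y)"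
      unfolding eventually_at by blast
    have "F (\<gamma> t, F (h t, y)) = F (\<gamma> t, y)" using h(2) y by simp
    with d(2) have "F (\<gamma> t, F (h s, y)) = F (\<gamma> s, y)" if "s \<in> T" "dist s t < d" for s
      using that by (cases "s = t") auto
    then show ?thesis
      by (rule has_vector_derivative_transform_within[OF der d(1) t])
  qed
  then obtain c where "\<And>t. t \<in> T \<Longrightarrow> F (\<gamma> t, y) = c"
    using has_vector_derivative_zero_constant[OF T(1), of "\<lambda>s. F (\<gamma> s, y)"] by blast
  then show ?thesis using T t by metis
qed

section \<open>Stationary points and the subalgebra annihilated by the orbit map\<close>

definition stationary :: "real^'n \<Rightarrow> bool" where
  "stationary y \<longleftrightarrow> (\<forall>X. trace X = 0 \<longrightarrow> \<rho> y X = 0)"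

text \<open>The radius \<open>\<eta>\<close> comes from \<open>unimodular_path\<close> alone and is
  the same for all \<open>y\<close>; the limit argument relies on this uniformity.\<close>

lemma stationary_fixed:
  obtains \<eta> where "\<eta> > 0" "\<eta> \<le> \<delta>"
    "\<And>y g. y \<in> C \<Longrightarrow> stationary y \<Longrightarrow> det g = 1 \<Longrightarrow> norm (g - mat 1) < \<eta> \<Longrightarrow> F (g, y) = y"
proof -
  obtain \<eta> where \<eta>: "\<eta> > 0" and
    path: "\<And>g :: real^'m^'m. det g = 1 \<Longrightarrow> norm (g - mat 1) < \<eta> \<Longrightarrow>
      \<exists>\<gamma> \<gamma>'. \<gamma> 0 = mat 1 \<and> \<gamma> 1 = g \<and> (\<forall>t\<in>{0..1}. (\<gamma> has_vector_derivative \<gamma>' t) (at t)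
        \<and> det (\<gamma> t) = 1 \<and> norm (\<gamma> t - mat 1) < \<delta>)"
    using unimodular_path[OF \<delta>] by metis
  show ?thesis
  proof (rule that[of "min \<eta> \<delta>"])
    fix y and g :: "real^'m^'m"
    assume y: "y \<in> C" "stationary y" and g: "det g = 1" "norm (g - mat 1) < min \<eta> \<delta>"
    obtain \<gamma> \<gamma>' where \<gamma>: "\<gamma> 0 = mat 1" "\<gamma> 1 = g"
      and \<gamma>': "\<And>t. t \<in> {0..1} \<Longrightarrow> (\<gamma> has_vector_derivative \<gamma>' t) (at t)"
      and dt: "\<And>t. t \<in> {0..1} \<Longrightarrow> det (\<gamma> t) = 1" and nt: "\<And>t. t \<in> {0..1} \<Longrightarrow> norm (\<gamma> t - mat 1) < \<delta>"
      using path[OF g(1)] g(2) unfolding min_less_iff_conj by blast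
    have "F (\<gamma> 1, y) = y"
    proof (rule path_fixes[of y "{0..1}" 0 \<gamma>])
      fix t :: real assume t: "t \<in> {0..1}"
      show "\<gamma> t \<in> B" using dt[OF t] nt[OF t] by (simp add: B_def)
      let ?i = "matrix_inv (\<gamma> t)"
      note i = matrix_inv_left_right[OF dt[OF t]]
      have "((\<lambda>s. ?i ** \<gamma> s) has_vector_derivative ?i ** \<gamma>' t) (at t within {0..1})"
        by (rule bounded_linear.has_vector_derivative[OF bounded_linear_matrix_mult_left
              has_vector_derivative_at_within[OF \<gamma>'[OF t]]])
      moreover have "\<rho> y (?i ** \<gamma>' t) = 0"
        using trace_derivative_unimodular_path[OF \<gamma>'[OF t] dt t] y(2) by (simp add: stationary_def)
      ultimately show "\<exists>h V. (\<forall>s\<in>{0..1}. \<gamma> s = \<gamma> t ** h s \<and> det (h s) = 1) \<and> h t = mat 1 \<and>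
          (h has_vector_derivative V) (at t within {0..1}) \<and> \<rho> y V = 0"
        using i dt by (intro exI[of _ "\<lambda>s. ?i ** \<gamma> s"] exI[of _ "?i ** \<gamma>' t"])
          (auto simp: matrix_mul_assoc det_mul)
    qed (use y \<gamma> in auto)
    then show "F (g, y) = y" using \<gamma> by simp
  qed (use \<eta> \<delta> in auto)
qed

text \<open>As \<open>outer u w\<close> has square zero,
  \<open>mat 1 + t *\<^sub>R outer u w\<close> is a one-parameter group. Its translates to the
  identity all have the velocity \<open>outer u w\<close>, so \<open>path_fixes\<close>
  applies.\<close>

lemma nilpotent_fixes:
  assumes y: "y \<in> C" and uw: "u \<bullet> w = 0" and \<rho>: "\<rho> y (outer u w) = 0"
  obtains t0 where "t0 > 0" "\<And>t. \<bar>t\<bar> < t0 \<Longrightarrow> mat 1 + t *\<^sub>R outer u w \<in> B \<and> F (mat 1 + t *\<^sub>R outer u w, y) = y"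
proof -
  let ?X = "outer u w"
  \<comment> \<open>The summand one keeps the quotient defined when \<open>?X\<close> is
    zero.\<close>
  define t0 where "t0 = \<delta> / (norm ?X + 1)"
  have pos: "norm ?X + 1 > 0" by (simp add: add_nonneg_pos)
  have t0: "t0 > 0" using \<delta> pos by (simp add: t0_def)
  let ?T = "{-t0<..<t0}" and ?\<gamma> = "\<lambda>t. mat 1 + t *\<^sub>R ?X"
  have det: "det (?\<gamma> t) = 1" for t
    using det_outer[of "t *\<^sub>R u" w] uw by (simp add: outer_scaleR)
  have "?X ** ?X = 0" using uw by (simp add: outer_mult_outer inner_commute[of w])
  then have mult: "?\<gamma> s ** ?\<gamma> t = ?\<gamma> (s + t)" for s t
    by (simp add: matrix_mult_simps scaleR_add_left)
  have B: "?\<gamma> t \<in> B" if "t \<in> ?T" for t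
  proof -
    have "\<bar>t\<bar> * norm ?X \<le> \<bar>t\<bar> * (norm ?X + 1)" by (intro mult_left_mono) auto
    also have "\<dots> < t0 * (norm ?X + 1)" using that pos by (intro mult_strict_right_mono) auto
    also have "\<dots> = \<delta>" using pos by (simp add: t0_def)
    finally show ?thesis using det by (simp add: B_def)
  qed
  have "F (?\<gamma> t, y) = y" if "t \<in> ?T" for t
  proof (rule path_fixes[OF y _ _ _ B _ that, of 0])
    fix t assume t: "t \<in> ?T"
    have "((\<lambda>s. ?\<gamma> (s - t)) has_vector_derivative ?X) (at t within ?T)"
      by (auto simp: has_vector_derivative_def intro!: derivative_eq_intros)
    then show "\<exists>h V. (\<forall>s\<in>?T. ?\<gamma> s = ?\<gamma> t ** h s \<and> det (h s) = 1) \<and> h t = mat 1 \<and>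
      (h has_vector_derivative V) (at t within ?T) \<and> \<rho> y V = 0"
      using det \<rho> by (intro exI[of _ "\<lambda>s. ?\<gamma> (s - t)"] exI[of _ ?X]) (simp add: mult)
  qed (use t0 y in auto)
  with B that[OF t0] show ?thesis by (auto simp: abs_less_iff)
qed

text \<open>For a curve \<open>h\<close> with velocity \<open>Y\<close>, the point
  \<open>g ** (h s ** g')\<close> applied to \<open>y\<close> is differentiated in two ways:
  directly, as a curve through the identity, and as \<open>g\<close> applied to
  \<open>F (h s, y)\<close>, since \<open>g'\<close> fixes \<open>y\<close>.\<close>

lemma \<rho>_conj:
  assumes y: "y \<in> C" and g: "g \<in> B" "g' \<in> B" "g ** g' = mat 1" "F (g', y) = y" and Y: "trace Y = 0"
  shows "\<rho> y (g ** (Y ** g')) = D g y (\<rho> y Y)"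
proof -
  obtain h where h: "h 0 = mat 1" "(h has_vector_derivative Y) (at 0)" "\<forall>\<^sub>F t in at 0. det (h t) = 1"
    using unimodular_curve[OF Y] by blast
  have lim: "(h \<longlongrightarrow> mat 1) (at 0)"
    using has_vector_derivative_continuous[OF h(2)] h(1) by (simp add: isCont_def)
  have det: "det g = 1" "det g' = 1" using g by (auto simp: B_def)
  have l1: "((\<lambda>s. h s ** g') \<longlongrightarrow> g') (at 0)"
    using tendsto_matrix_mult[OF lim tendsto_const[of g']] by simp
  have l2: "((\<lambda>s. g ** (h s ** g')) \<longlongrightarrow> mat 1) (at 0)"
    using tendsto_matrix_mult[OF tendsto_const[of g] l1] g by simp
  have "\<forall>\<^sub>F s in at 0. h s ** g' \<in> B"
    by (rule eventually_B[OF l1 g(2)]) (use h(3) det in \<open>auto simp: det_mul elim: eventually_mono\<close>)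
  moreover have "\<forall>\<^sub>F s in at 0. g ** (h s ** g') \<in> B"
    by (rule eventually_B[OF l2 mat_1_B]) (use h(3) det in \<open>auto simp: det_mul elim: eventually_mono\<close>)
  ultimately have "\<forall>\<^sub>F s in at 0. F (g, F (h s, y)) = F (g ** (h s ** g'), y)"
    using eventually_F_C[OF lim y h(3)]
  proof eventually_elim
    case (elim s)
    have "F (h s ** g', y) = F (h s, y)" using F_mult[of "h s" g' y] elim g y by simp
    then show ?case using F_mult[of g "h s ** g'" y] elim g y by simp
  qed
  then obtain d where d: "d > 0" "\<And>s. s \<noteq> 0 \<Longrightarrow> dist s 0 < d \<Longrightarrow> F (g, F (h s, y)) = F (g ** (h s ** g'), y)"
    unfolding eventually_at by auto
  have d0: "F (g, F (h 0, y)) = F (g ** (h 0 ** g'), y)"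
    using h(1) g y F_mult[of g g' y] by simp
  have "((\<lambda>s. g ** (h s ** g')) has_vector_derivative g ** (Y ** g')) (at 0)"
    by (intro bounded_linear.has_vector_derivative[OF bounded_linear_matrix_mult_left]
        bounded_linear.has_vector_derivative[OF bounded_linear_matrix_mult_right] h)
  then have "((\<lambda>s. F (g ** (h s ** g'), y)) has_vector_derivative \<rho> y (g ** (Y ** g'))) (at 0)"
    by (rule curve_derivative) (use y h g in auto)
  moreover have "((\<lambda>s. F (g ** (h s ** g'), y)) has_vector_derivative D g y (\<rho> y Y)) (at 0)"
  proof (rule has_vector_derivative_transform_within[OF curve_derivative'[OF h(2,1) y g(1)] d(1) UNIV_I])
    fix s :: real assume "dist s 0 < d"
    then show "F (g, F (h s, y)) = F (g ** (h s ** g'), y)" using d(2) d0 by (cases "s = 0") auto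
  qed
  ultimately show ?thesis by (rule vector_derivative_unique_at)
qed

text \<open>Conjugating \<open>Z\<close> by \<open>mat 1 + t *\<^sub>R outer u w\<close> gives a
  quadratic polynomial in \<open>t\<close> whose linear coefficient is the bracket. By
  \<open>\<rho>_conj\<close> the map \<open>\<rho> y\<close> annihilates it for all small
  \<open>t\<close>; comparing \<open>t\<close> with \<open>- t\<close> isolates the linear
  coefficient, without second derivatives of the action.\<close>

lemma \<rho>_bracket:
  assumes y: "y \<in> C" and uw: "u \<bullet> w = 0" and \<rho>: "\<rho> y (outer u w) = 0"
    and Z: "trace Z = 0" "\<rho> y Z = 0"
  shows "\<rho> y (outer u w ** Z - Z ** outer u w) = 0"
proof -
  let ?X = "outer u w"
  obtain t0 where t0: "t0 > 0" "\<And>t. \<bar>t\<bar> < t0 \<Longrightarrow> mat 1 + t *\<^sub>R ?X \<in> B \<and> F (mat 1 + t *\<^sub>R ?X, y) = y"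
    using nilpotent_fixes[OF y uw \<rho>] by blast
  have XX: "?X ** ?X = 0" using uw by (simp add: outer_mult_outer inner_commute[of w])
  have *: "\<rho> y Z + t *\<^sub>R \<rho> y (?X ** Z - Z ** ?X) - t\<^sup>2 *\<^sub>R \<rho> y (?X ** (Z ** ?X)) = 0" if t: "\<bar>t\<bar> < t0" for t
  proof -
    let ?g = "mat 1 + t *\<^sub>R ?X" and ?g' = "mat 1 + (-t) *\<^sub>R ?X"
    have "?g ** ?g' = mat 1" by (simp add: matrix_mult_simps XX)
    then have "\<rho> y (?g ** (Z ** ?g')) = D ?g y (\<rho> y Z)"
      using t0(2)[of t] t0(2)[of "-t"] t by (intro \<rho>_conj[OF y _ _ _ _ Z(1)]) auto
    also have "\<dots> = 0" using Z(2) linear_0[OF linear_D] by simp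
    also have "?g ** (Z ** ?g') = Z + t *\<^sub>R (?X ** Z - Z ** ?X) - t\<^sup>2 *\<^sub>R (?X ** (Z ** ?X))"
      by (simp add: matrix_mult_simps power2_eq_square algebra_simps)
    finally show ?thesis
      by (simp add: linear_add[OF linear_\<rho>] linear_diff[OF linear_\<rho>] linear_cmul[OF linear_\<rho>])
  qed
  have "(t0 / 2) *\<^sub>R \<rho> y (?X ** Z - Z ** ?X) = (t0 / 2)\<^sup>2 *\<^sub>R \<rho> y (?X ** (Z ** ?X))"
    "- ((t0 / 2) *\<^sub>R \<rho> y (?X ** Z - Z ** ?X)) = (t0 / 2)\<^sup>2 *\<^sub>R \<rho> y (?X ** (Z ** ?X))"
    using *[of "t0 / 2"] *[of "- (t0 / 2)"] t0(1) by (simp_all add: Z(2) eq_neg_iff_add_eq_0)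
  then have "(t0 / 2) *\<^sub>R \<rho> y (?X ** Z - Z ** ?X) + (t0 / 2) *\<^sub>R \<rho> y (?X ** Z - Z ** ?X) = 0"
    by (metis add.left_inverse)
  then have "(t0 / 2 + t0 / 2) *\<^sub>R \<rho> y (?X ** Z - Z ** ?X) = 0"
    by (simp only: scaleR_add_left)
  then show ?thesis using t0(1) by simp
qed

lemma boundary_normal_velocity:
  assumes y: "y \<in> C" "y $ k = 0" and X: "trace X = 0"
  shows "\<rho> y X $ k = 0"
proof -
  obtain h where h: "h 0 = mat 1" "(h has_vector_derivative X) (at 0)" "\<forall>\<^sub>F t in at 0. det (h t) = 1"
    using unimodular_curve[OF X] by blast
  have lim: "(h \<longlongrightarrow> mat 1) (at 0)"
    using has_vector_derivative_continuous[OF h(2)] h(1) by (simp add: isCont_def)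
  let ?c = "\<lambda>s. F (h s, y) $ k"
  have "(?c has_vector_derivative \<rho> y X $ k) (at 0)"
    by (rule bounded_linear.has_vector_derivative[OF bounded_linear_vec_nth curve_derivative[OF h(2,1) y(1)]])
  then have "DERIV ?c 0 :> \<rho> y X $ k"
    by (simp add: has_real_derivative_iff_has_vector_derivative)
  moreover have "\<forall>\<^sub>F s in at 0. ?c 0 \<le> ?c s"
    using eventually_F_C[OF lim y(1) h(3)] by eventually_elim (use y h(1) in \<open>simp add: C_def half_space_def\<close>)
  then obtain d where "d > 0" "\<And>s. s \<noteq> 0 \<Longrightarrow> dist s 0 < d \<Longrightarrow> ?c 0 \<le> ?c s"
    unfolding eventually_at by auto
  then have "\<forall>s. \<bar>0 - s\<bar> < d \<longrightarrow> ?c 0 \<le> ?c s" by (auto simp: dist_real_def) (metis order_refl)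
  ultimately show ?thesis using DERIV_local_min \<open>d > 0\<close> by blast
qed

lemma boundary_stationary:
  assumes y: "y \<in> C" "y $ k = 0"
  shows "stationary y"
  unfolding stationary_def
proof (intro allI impI)
  fix X :: "real^'m^'m" assume X: "trace X = 0"
  \<comment> \<open>\<open>?b i\<close> represents the functional giving component \<open>i\<close>
    of the velocity. Component \<open>k\<close> is left out, as it vanishes on trace zero matrices;
    with \<open>mat 1\<close> at most n matrices remain. Orthogonality to \<open>mat 1\<close> also
    gives \<open>u \<bullet> w = 0\<close> for \<open>outer u w\<close> in the kernel.\<close>
  let ?b = "\<lambda>i. adjoint (\<rho> y) (axis i 1)"
  let ?S = "insert (mat 1) (?b ` (UNIV - {k}))"
  have b: "?b i \<bullet> Z = \<rho> y Z $ i" for i Z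
    using adjoint_works[OF linear_\<rho>, of Z y "axis i 1"] by (simp add: inner_commute[of "?b i"] inner_axis)
  have zero: "\<rho> y Z = 0 \<and> trace Z = 0" if "\<And>b. b \<in> ?S \<Longrightarrow> b \<bullet> Z = 0" for Z
  proof -
    have t: "trace Z = 0" using that by (simp add: trace_eq_inner)
    have "\<rho> y Z $ i = 0" for i
    proof (cases "i = k")
      case False
      then show ?thesis using that[of "?b i"] b by auto
    qed (use boundary_normal_velocity[OF y t] in simp)
    with t show ?thesis by (simp add: vec_eq_iff)
  qed
  have "card ?S \<le> Suc (card (?b ` (UNIV - {k})))" by (simp add: card_insert_if)
  also have "\<dots> \<le> Suc (card (UNIV - {k}))" by (intro Suc_le_mono[THEN iffD2] card_image_le) simp
  also have "\<dots> = CARD('n)" by (simp add: card_Diff_singleton)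
  finally have card: "card ?S < CARD('m)" using dim by simp
  have "b \<bullet> X = 0" if "b \<in> ?S" for b
  proof (rule no_small_codim_subalgebra[OF _ card _ _ that X])
    fix u w :: "real^'m" and Z b
    assume uw: "\<And>b. b \<in> ?S \<Longrightarrow> b \<bullet> outer u w = 0" and Z: "\<And>b. b \<in> ?S \<Longrightarrow> b \<bullet> Z = 0" and b': "b \<in> ?S"
    have 1: "\<rho> y (outer u w) = 0 \<and> trace (outer u w) = 0" by (rule zero) (rule uw)
    have 2: "\<rho> y Z = 0 \<and> trace Z = 0" by (rule zero) (rule Z)
    have "\<rho> y (outer u w ** Z - Z ** outer u w) = 0"
      by (rule \<rho>_bracket[OF y(1)]) (use 1 2 trace_outer[of u w] in simp_all)
    moreover have "mat 1 \<bullet> (outer u w ** Z - Z ** outer u w) = 0"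
      unfolding trace_eq_inner[symmetric] trace_sub trace_mul_sym[of "outer u w" Z] by simp
    ultimately show "b \<bullet> (outer u w ** Z - Z ** outer u w) = 0"
      using b' b by (elim insertE imageE) simp_all
  qed auto
  then show "\<rho> y X = 0" using zero[of X] by blast
qed

text \<open>The chain rule at the fixed point makes the isotropy representation multiplicative. The
  group law holds on the half-space only, so the derivatives are compared within it.\<close>

lemma D_comp:
  assumes g: "g \<in> B" "h \<in> B" "g ** h \<in> B" and fix_p: "F (h, p) = p"
  shows "D (g ** h) p v = D g p (D h p v)"
proof -
  let ?S = "half_space k"
  have "((\<lambda>z. F (g, F (h, z))) has_derivative (\<lambda>v. D g p (D h p v))) (at p within ?S)"
  proof (rule has_derivative_compose[OF D_has_derivative[OF g(2) p_C]])
    show "((\<lambda>z. F (g, z)) has_derivative D g p) (at (F (h, p)))"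
      using D_has_derivative[OF g(1) p_C] fix_p by simp
  qed
  moreover have "\<forall>\<^sub>F z in at p within ?S. F (g, F (h, z)) = F (g ** h, z)"
  proof -
    have "((\<lambda>z. norm (z - p)) \<longlongrightarrow> norm (p - p)) (at p within ?S)"
      by (intro tendsto_intros)
    then have 1: "\<forall>\<^sub>F z in at p within ?S. norm (z - p) < e"
      by (rule order_tendstoD) (use e in simp)
    have "((\<lambda>z. norm (F (h, z) - p)) \<longlongrightarrow> norm (F (h, p) - p)) (at p within ?S)"
      by (intro tendsto_intros tendsto_F g p_C)
    then have 2: "\<forall>\<^sub>F z in at p within ?S. norm (F (h, z) - p) < e"
      by (rule order_tendstoD) (use e fix_p in simp)
    have 3: "\<forall>\<^sub>F z in at p within ?S. z \<in> ?S" by (simp add: eventually_at_filter)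
    from 1 2 3 show ?thesis
    proof eventually_elim
      case (elim z)
      then have z: "z \<in> C" by (simp add: C_def)
      moreover have "F (h, z) \<in> C" using F_half[OF g(2) z] elim by (simp add: C_def)
      ultimately show ?case using F_mult g by blast
    qed
  qed
  ultimately have "((\<lambda>z. F (g ** h, z)) has_derivative (\<lambda>v. D g p (D h p v))) (at p within ?S)"
    by (rule has_derivative_transform_eventually) (use p F_mult[OF g p_C] fix_p in simp_all)
  from has_derivative_unique_half_space[OF D_has_derivative[OF g(3) p_C] this p]
  show ?thesis by metis
qed

lemma D_eq_id:
  assumes g: "g \<in> B" and y: "y \<in> C" and d: "d > 0" "\<And>z. z \<in> C \<Longrightarrow> norm (z - y) < d \<Longrightarrow> F (g, z) = z"
  shows "D g y v = v"
proof -
  let ?S = "half_space k"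
  have y': "y \<in> ?S" using y by (simp add: C_def)
  have "\<forall>\<^sub>F z in at y within ?S. norm (z - p) < e \<and> norm (z - y) < d \<and> z \<in> ?S"
  proof (intro eventually_conj)
    have "((\<lambda>z. norm (z - p)) \<longlongrightarrow> norm (y - p)) (at y within ?S)" by (intro tendsto_intros)
    then show "\<forall>\<^sub>F z in at y within ?S. norm (z - p) < e"
      by (rule order_tendstoD) (use y in \<open>simp add: C_def\<close>)
    have "((\<lambda>z. norm (z - y)) \<longlongrightarrow> norm (y - y)) (at y within ?S)" by (intro tendsto_intros)
    then show "\<forall>\<^sub>F z in at y within ?S. norm (z - y) < d"
      by (rule order_tendstoD) (use d in simp)
  qed (simp add: eventually_at_filter)
  then have "\<forall>\<^sub>F z in at y within ?S. z = F (g, z)"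
    by eventually_elim (simp add: C_def d(2))
  then have "((\<lambda>z. F (g, z)) has_derivative (\<lambda>v. v)) (at y within ?S)"
    by (rule has_derivative_transform_eventually[OF has_derivative_ident]) (use y y' d in simp_all)
  from has_derivative_unique_half_space[OF D_has_derivative[OF g y] this y'] show ?thesis by metis
qed

lemma D_mat_1: "y \<in> C \<Longrightarrow> D (mat 1) y v = v"
  by (rule D_eq_id[of _ _ 1]) simp_all

lemma F'_near_mat_1:
  assumes "\<epsilon> > 0"
  obtains d where "d > 0" "d \<le> \<delta>" "\<And>g v. norm ((g :: real^'m^'m) - mat 1) < d \<Longrightarrow> norm (D g p v - v) \<le> \<epsilon> * norm v"
proof -
  have "continuous_on {g. norm (g - mat 1) < \<delta>} (\<lambda>g. F' (g, p))"
    by (rule continuous_on_compose2[OF cont]) (use e in \<open>auto intro!: continuous_intros\<close>)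
  moreover have "open {g :: real^'m^'m. norm (g - mat 1) < \<delta>}"
    by (intro open_Collect_less continuous_intros)
  ultimately have "isCont (\<lambda>g. F' (g, p)) (mat 1)"
    using \<delta> by (simp add: continuous_on_eq_continuous_at)
  then obtain d where d: "d > 0" "\<And>g. dist g (mat 1) < d \<Longrightarrow> dist (F' (g, p)) (F' (mat 1, p)) < \<epsilon>"
    using assms unfolding continuous_at_eps_delta by blast
  show ?thesis
  proof (rule that[of "min d \<delta>"])
    fix g :: "real^'m^'m" and v assume g: "norm (g - mat 1) < min d \<delta>"
    have "D g p v - v = (F' (g, p) - F' (mat 1, p)) (0, v)"
      using D_mat_1[OF p_C, of v] by (simp add: D_def blinfun.diff_left)
    also have "norm \<dots> \<le> norm (F' (g, p) - F' (mat 1, p)) * norm (0 :: real^'m^'m, v)"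
      by (rule norm_blinfun)
    also have "\<dots> \<le> \<epsilon> * norm v"
      using d(2)[of g] g assms by (intro mult_mono) (auto simp: dist_norm norm_Pair)
    finally show "norm (D g p v - v) \<le> \<epsilon> * norm v" .
  qed (use d \<delta> in auto)
qed

definition isotropic :: "real^'m^'m \<Rightarrow> bool" where
  "isotropic g \<longleftrightarrow> g \<in> B \<and> F (g, p) = p \<and> (\<forall>v. D g p v = v)"

lemma isotropic_mult:
  assumes "isotropic g" "isotropic h" "g ** h \<in> B" shows "isotropic (g ** h)"
  using assms D_comp[of g h] F_mult[of g h p] by (simp add: isotropic_def)

text \<open>At a boundary point the isotropy representation fixes the tangent space of the boundary, so it
  takes values in a solvable group: it is determined by a homomorphism \<open>\<lambda>\<close> to the multiplicative group
  and, where \<open>\<lambda> = 1\<close>, by one to a vector group.\<close>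

lemma boundary_isotropic:
  assumes pk: "p $ k = 0"
  obtains r where "r > 0" "\<And>i j s. i \<noteq> j \<Longrightarrow> \<bar>s\<bar> < r \<Longrightarrow> isotropic (transvection i j s)"
proof -
  let ?a = "axis k (1::real)"
  obtain \<eta> where \<eta>: "\<eta> > 0" "\<eta> \<le> \<delta>"
    "\<And>y g. y \<in> C \<Longrightarrow> stationary y \<Longrightarrow> det g = 1 \<Longrightarrow> norm (g - mat 1) < \<eta> \<Longrightarrow> F (g, y) = y"
    using stationary_fixed by blast
  obtain d where d: "d > 0" "d \<le> \<delta>" "\<And>g v. norm (g - mat 1) < d \<Longrightarrow> norm (D g p v - v) \<le> 1 / 2 * norm v"
    using F'_near_mat_1[of "1 / 2"] by auto
  define \<delta>' where "\<delta>' = min \<eta> d"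
  define G where "G = {g :: real^'m^'m. det g = 1 \<and> norm (g - mat 1) < \<delta>'}"
  have \<delta>': "\<delta>' > 0" using \<eta> d by (simp add: \<delta>'_def)
  have GB: "g \<in> B" if "g \<in> G" for g using that \<eta> by (simp add: G_def B_def \<delta>'_def)
  have fix_y: "F (g, y) = y" if "g \<in> G" "y \<in> C" "y $ k = 0" for g y
    using that \<eta>(3) boundary_stationary by (simp add: G_def \<delta>'_def)
  have fix_p: "F (g, p) = p" if "g \<in> G" for g using fix_y that pk by simp
  \<comment> \<open>Near \<open>p\<close> the line in direction \<open>v\<close> stays in the
    boundary, whose points \<open>g\<close> fixes.\<close>
  have tang: "D g p v = v" if g: "g \<in> G" and v: "v $ k = 0" for g v
  proof -
    let ?l = "\<lambda>t::real. p + t *\<^sub>R v"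
    have l: "(?l has_derivative (\<lambda>t. t *\<^sub>R v)) (at 0)" by (auto intro!: derivative_eq_intros)
    have "(F o Pair g has_derivative D g p) (at (?l 0))"
      using D_has_derivative[OF GB[OF g] p_C, of UNIV] by (simp add: o_def)
    from diff_chain_at[OF l this] have 1: "((\<lambda>t. F (g, ?l t)) has_vector_derivative D g p v) (at 0)"
      by (simp add: o_def has_vector_derivative_def linear_cmul[OF linear_D])
    have "((\<lambda>t. norm (?l t - p)) \<longlongrightarrow> norm (?l 0 - p)) (at 0)" by (intro tendsto_intros)
    then have "\<forall>\<^sub>F t in at 0. norm (?l t - p) < e" by (rule order_tendstoD) (use e in simp)
    then obtain c where c: "c > 0" "\<And>t. t \<noteq> 0 \<Longrightarrow> dist t 0 < c \<Longrightarrow> norm (?l t - p) < e"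
      unfolding eventually_at by auto
    have "F (g, ?l t) = ?l t" if "dist t 0 < c" for t
    proof (rule fix_y[OF g])
      have "norm (?l t - p) < e" using c(2)[OF _ that] e by (cases "t = 0") auto
      then show "?l t \<in> C" using pk v by (simp add: C_def half_space_def)
    qed (use pk v in simp)
    then have "(?l has_vector_derivative D g p v) (at 0)"
      by (intro has_vector_derivative_transform_within[OF 1 c(1)]) auto
    moreover have "(?l has_vector_derivative v) (at 0)"
      using l by (simp add: has_vector_derivative_def)
    ultimately show ?thesis by (rule vector_derivative_unique_at)
  qed
  have split: "D g p v = v + (v $ k) *\<^sub>R (D g p ?a - ?a)" if "g \<in> G" for g v
  proof -
    have "D g p v = D g p (v - (v $ k) *\<^sub>R ?a) + (v $ k) *\<^sub>R D g p ?a"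
      using linear_add[OF linear_D, of g p "v - (v $ k) *\<^sub>R ?a" "(v $ k) *\<^sub>R ?a"] linear_cmul[OF linear_D, of g p "v $ k" ?a]
      by simp
    then show ?thesis using tang[OF that, of "v - (v $ k) *\<^sub>R ?a"]
      by (simp add: axis_def algebra_simps)
  qed
  \<comment> \<open>The homomorphism \<lambda>: the factor by which the isotropy representation
    scales the direction transverse to the boundary.\<close>
  define l where "l g = D g p ?a $ k" for g
  have small: "norm (D g p ?a - ?a) \<le> 1 / 2" if "g \<in> G" for g
    using d(3)[of g ?a] that by (simp add: G_def \<delta>'_def norm_axis_1)
  have l: "1 / 2 \<le> l g" "l g \<le> 3 / 2" if "g \<in> G" for g
    using component_le_norm_cart[of "D g p ?a - ?a" k] small[OF that] by (auto simp: l_def axis_def abs_le_iff)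
  have mult: "D (g ** h) p ?a - ?a = (D h p ?a - ?a) + l h *\<^sub>R (D g p ?a - ?a)"
    if "g \<in> G" "h \<in> G" "g ** h \<in> G" for g h
    using D_comp[OF GB GB GB fix_p, OF that that(2)] split[OF that(1), of "D h p ?a"] by (simp add: l_def)
  have l_mult: "l (g ** h) = l g * l h" if "g \<in> G" "h \<in> G" "g ** h \<in> G" for g h
    using arg_cong[OF mult[OF that], of "\<lambda>v. v $ k"] by (simp add: l_def axis_def algebra_simps)
  obtain r K :: real where r: "r > 0" "r < \<delta>'" "K \<ge> 0" and thurston:
    "\<And>(i::'m::finite) j H (f :: real^'m^'m \<Rightarrow> real^'n) \<epsilon> m s.
      i \<noteq> j \<Longrightarrow> \<bar>s\<bar> \<le> r \<Longrightarrow> 0 \<le> \<epsilon> \<Longrightarrow> \<epsilon> \<le> 1 \<Longrightarrow> approximate_hom \<delta>' H f \<epsilon> \<Longrightarrow>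
      \<forall>t. \<bar>t\<bar> \<le> r \<longrightarrow> transvection i j t \<in> H \<and> transvection j i t \<in> H \<Longrightarrow>
      \<forall>t. \<bar>t\<bar> \<le> r \<longrightarrow> norm (f (transvection i j t)) \<le> m \<and> norm (f (transvection j i t)) \<le> m \<Longrightarrow>
      norm (f (transvection i j s)) \<le> K * \<epsilon> * m"
    using approximate_hom_transvection[where 'm='m and 'v="real^'n", OF \<delta>'] by auto
  have EG: "transvection i j t \<in> G" if "i \<noteq> j" "\<bar>t\<bar> \<le> r" for i j t
    using that r by (simp add: G_def det_transvection norm_transvection)
  have multG: "g ** h \<in> G" if "g \<in> G" "h \<in> G" "norm (g ** h - mat 1) < \<delta>'" for g h
    using that by (simp add: G_def det_mul)
  have l1: "l (transvection i j s) = 1" if ij: "i \<noteq> j" and s: "\<bar>s\<bar> \<le> r" for i j s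
  proof -
    \<comment> \<open>The logarithm makes \<lambda> additive, and \<open>?a\<close> makes it vector
      valued. It is an exact homomorphism on \<open>G\<close>, so the estimate with error zero
      forces it to vanish on small transvections.\<close>
    let ?f = "\<lambda>g. ln (l g) *\<^sub>R ?a"
    have b: "norm (?f g) \<le> 1" if "g \<in> G" for g
    proof -
      have "ln (l g) \<le> 1" using ln_le_minus_one[of "l g"] l[OF that] by linarith
      moreover have "1 / l g \<le> 2" using l[OF that] by (simp add: field_simps)
      then have "- ln (l g) \<le> 1"
        using ln_le_minus_one[of "1 / l g"] l[OF that] by (simp add: ln_div)
      ultimately show ?thesis by (simp add: norm_axis_1 abs_le_iff)
    qed
    have "norm (?f (transvection i j s)) \<le> K * 0 * 1"
    proof (rule thurston[OF ij s, of 0 G])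
      show "approximate_hom \<delta>' G ?f 0"
        unfolding approximate_hom_def
      proof (intro conjI ballI impI)
        fix g h assume "g \<in> G" "h \<in> G" "g ** h \<in> G"
        then have "ln (l (g ** h)) = ln (l g) + ln (l h)"
          using l_mult l[of g] l[of h] by (simp add: ln_mult)
        then show "norm (?f (g ** h) - ?f g - ?f h) \<le> 0 * norm (?f h)" by (simp add: algebra_simps)
      qed (use multG in blast)
    qed (use EG ij b in auto)
    then have "ln (l (transvection i j s)) = 0" by (simp add: axis_eq_0_iff)
    then show ?thesis using l[OF EG[OF ij s]] by simp
  qed
  \<comment> \<open>Where \<open>l\<close> is one, the twisted rule \<open>mult\<close> becomes
    additive, and the same argument applies to the remaining vector part.\<close>
  let ?H = "{g \<in> G. l g = 1}" and ?f = "\<lambda>g. D g p ?a - ?a"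
  have "?f (transvection i j s) = 0" if ij: "i \<noteq> j" and s: "\<bar>s\<bar> \<le> r" for i j s
  proof -
    have "norm (?f (transvection i j s)) \<le> K * 0 * (1 / 2)"
    proof (rule thurston[OF ij s, of 0 ?H])
      show "approximate_hom \<delta>' ?H ?f 0"
        unfolding approximate_hom_def
      proof (intro conjI ballI impI)
        fix g h assume gh: "g \<in> ?H" "h \<in> ?H"
        show "norm (g ** h - mat 1) < \<delta>' \<Longrightarrow> g ** h \<in> ?H"
          using multG[of g h] l_mult[of g h] gh by simp
        assume "g ** h \<in> ?H"
        then show "norm (?f (g ** h) - ?f g - ?f h) \<le> 0 * norm (?f h)"
          using mult[of g h] gh by simp
      qed
      show "\<forall>t. \<bar>t\<bar> \<le> r \<longrightarrow> transvection i j t \<in> ?H \<and> transvection j i t \<in> ?H"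
        using EG l1 ij by auto
      show "\<forall>t. \<bar>t\<bar> \<le> r \<longrightarrow> norm (?f (transvection i j t)) \<le> 1 / 2 \<and> norm (?f (transvection j i t)) \<le> 1 / 2"
        using small EG ij by auto
    qed simp_all
    then show ?thesis by simp
  qed
  then have "isotropic (transvection i j s)" if "i \<noteq> j" "\<bar>s\<bar> \<le> r" for i j s
    using EG[OF that] GB fix_p split that unfolding isotropic_def by (metis add.right_neutral scaleR_zero_right)
  then show ?thesis using that[OF r(1)] by (meson less_imp_le)
qed

text \<open>Thurston stability: near \<open>p\<close> the displacement \<open>g \<mapsto> F (g, y) - y\<close> is a homomorphism on isotropic
  elements, up to an error that is small relative to the displacements themselves.\<close>

lemma isotropic_imp_fixes_near:
  assumes r0: "r0 > 0" and iso: "\<And>s. \<bar>s\<bar> < r0 \<Longrightarrow> isotropic (transvection i j s) \<and> isotropic (transvection j i s)"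
    and ij: "i \<noteq> j"
  obtains r d where "r > 0" "d > 0"
    "\<And>y s. y \<in> C \<Longrightarrow> norm (y - p) < d \<Longrightarrow> \<bar>s\<bar> \<le> r \<Longrightarrow> F (transvection i j s, y) = y"
proof -
  define \<delta>' where "\<delta>' = min (\<delta> / 2) r0"
  have \<delta>': "\<delta>' > 0" "\<delta>' \<le> r0" "\<delta>' \<le> \<delta> / 2" using \<delta> r0 by (auto simp: \<delta>'_def)
  obtain r K :: real where r: "r > 0" "r < \<delta>'" "K \<ge> 0" and thurston:
    "\<And>(i::'m::finite) j H (f :: real^'m^'m \<Rightarrow> real^'n) \<epsilon> m s.
      i \<noteq> j \<Longrightarrow> \<bar>s\<bar> \<le> r \<Longrightarrow> 0 \<le> \<epsilon> \<Longrightarrow> \<epsilon> \<le> 1 \<Longrightarrow> approximate_hom \<delta>' H f \<epsilon> \<Longrightarrow>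
      \<forall>t. \<bar>t\<bar> \<le> r \<longrightarrow> transvection i j t \<in> H \<and> transvection j i t \<in> H \<Longrightarrow>
      \<forall>t. \<bar>t\<bar> \<le> r \<longrightarrow> norm (f (transvection i j t)) \<le> m \<and> norm (f (transvection j i t)) \<le> m \<Longrightarrow>
      norm (f (transvection i j s)) \<le> K * \<epsilon> * m"
    using approximate_hom_transvection[where 'm='m and 'v="real^'n", OF \<delta>'(1)] by auto
  \<comment> \<open>With \<open>K * \<epsilon> \<le> 1 / 2\<close> every application of the estimate
    halves the bound on the displacements.\<close>
  define \<epsilon> where "\<epsilon> = 1 / (2 * (K + 1))"
  have \<epsilon>: "\<epsilon> > 0" "\<epsilon> \<le> 1" "K * \<epsilon> \<le> 1 / 2" using r(3) by (auto simp: \<epsilon>_def field_simps)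
  define H where "H = {g. isotropic g \<and> norm (g - mat 1) < \<delta>'}"
  have HB: "g \<in> B" "F (g, p) = p" "D g p v = v" "norm (g - mat 1) \<le> \<delta> / 2" if "g \<in> H" for g v
    using that \<delta>' by (auto simp: H_def isotropic_def)
  \<comment> \<open>Half the radii give a compact set inside the domain of \<open>F'\<close>, so one
    \<open>d\<close> serves all \<open>g\<close> in \<open>H\<close>.\<close>
  let ?K = "cball (mat 1) (\<delta> / 2) \<times> cball p (e / 2) :: ((real^'m^'m) \<times> (real^'n)) set"
  have "uniformly_continuous_on ?K F'"
  proof (rule compact_uniformly_continuous)
    show "continuous_on ?K F'"
      by (rule continuous_on_subset[OF cont]) (use \<delta> e in \<open>auto simp: dist_norm norm_minus_commute\<close>)
    show "compact ?K" by (intro compact_Times compact_cball)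
  qed
  then obtain d0 where d0: "d0 > 0"
    "\<And>a b. a \<in> ?K \<Longrightarrow> b \<in> ?K \<Longrightarrow> dist b a < d0 \<Longrightarrow> dist (F' b) (F' a) < \<epsilon>"
    unfolding uniformly_continuous_on_def using \<epsilon>(1) by blast
  define d where "d = min d0 (e / 2)"
  have d: "d > 0" "d \<le> e / 2" "d \<le> d0" using d0 e by (auto simp: d_def)
  have F'd: "norm (F' (g, y) - F' (g, p)) \<le> \<epsilon>" if "g \<in> H" "norm (y - p) < d" for g y
    using d0(2)[of "(g, p)" "(g, y)"] HB(4)[OF that(1)] that(2) d e
    by (auto simp: dist_norm norm_minus_commute norm_Pair)
  \<comment> \<open>For isotropic \<open>g\<close> the derivative of the displacement vanishes at
    \<open>p\<close>, so it is at most \<open>\<epsilon>\<close> nearby. The mean value inequality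
    is applied on a full ball, where the extension \<open>F\<close> is differentiable.\<close>
  have mvt: "norm (F (g, y) - F (g, z) - (y - z)) \<le> \<epsilon> * norm (y - z)"
    if g: "g \<in> H" and yz: "norm (y - p) < d" "norm (z - p) < d" for g y z
  proof -
    let ?\<phi> = "\<lambda>x. F (g, x) - x"
    have "norm (?\<phi> y - ?\<phi> z) \<le> \<epsilon> * norm (y - z)"
    proof (rule differentiable_bound[of "ball p d" _ "\<lambda>x v. D g x v - v"])
      fix x assume x: "x \<in> ball p d"
      then have x': "norm (x - p) < d" by (simp add: dist_norm norm_minus_commute)
      have "((\<lambda>z. (g, z)) has_derivative (\<lambda>v. (0, v))) (at x)"
        by (auto intro!: derivative_eq_intros)
      from has_derivative_compose[OF this, of F] deriv[of g x] HB(4)[OF g] \<delta> x' d e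
      have "((\<lambda>x. F (g, x)) has_derivative D g x) (at x)" unfolding D_def by simp
      then show "(?\<phi> has_derivative (\<lambda>v. D g x v - v)) (at x within ball p d)"
        by (intro has_derivative_diff has_derivative_ident has_derivative_at_withinI[where s="ball p d"])
      show "onorm (\<lambda>v. D g x v - v) \<le> \<epsilon>"
      proof (rule onorm_le)
        fix v
        have "D g x v - v = (F' (g, x) - F' (g, p)) (0, v)"
          using HB(3)[OF g, of v] by (simp add: D_def blinfun.diff_left)
        also have "norm \<dots> \<le> norm (F' (g, x) - F' (g, p)) * norm (0 :: real^'m^'m, v)"
          by (rule norm_blinfun)
        also have "\<dots> \<le> \<epsilon> * norm v"
          using F'd[OF g x'] \<epsilon>(1) by (intro mult_mono) (auto simp: norm_Pair)
        finally show "norm (D g x v - v) \<le> \<epsilon> * norm v" .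
      qed
    qed (use yz in \<open>auto simp: dist_norm norm_minus_commute\<close>)
    then show ?thesis by (simp add: algebra_simps)
  qed
  show ?thesis
  proof (rule that[of r "d / 2"])
    fix y s assume y: "y \<in> C" "norm (y - p) < d / 2" and s: "\<bar>s\<bar> \<le> r"
    let ?f = "\<lambda>g. F (g, y) - y"
    have yd: "norm (y - p) < d" using y d by linarith
    have Fy: "norm (F (g, y) - p) < d" if "g \<in> H" for g
    proof -
      have "norm (F (g, y) - F (g, p) - (y - p)) \<le> \<epsilon> * norm (y - p)"
        by (rule mvt) (use that yd d in auto)
      also have "\<dots> \<le> 1 * norm (y - p)" using \<epsilon> by (intro mult_right_mono) auto
      finally have "norm (F (g, y) - p - (y - p)) \<le> norm (y - p)" using HB(2)[OF that] by simp
      then show ?thesis using y(2) norm_triangle_ineq[of "F (g, y) - p - (y - p)" "y - p"] by simp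
    qed
    have FC: "F (g, y) \<in> C" if "g \<in> H" for g
      using F_half[OF HB(1)[OF that] y(1)] Fy[OF that] d by (simp add: C_def)
    have multH: "g ** h \<in> H" if "g \<in> H" "h \<in> H" "norm (g ** h - mat 1) < \<delta>'" for g h
      using that isotropic_mult[of g h] \<delta>' \<delta> by (auto simp: H_def B_def isotropic_def det_mul)
    have hom: "norm (?f (g ** h) - ?f g - ?f h) \<le> \<epsilon> * norm (?f h)" if "g \<in> H" "h \<in> H" "g ** h \<in> H" for g h
    proof -
      have "F (g ** h, y) = F (g, F (h, y))"
        using F_mult[of g h y] HB(1) that y FC by simp
      then have "?f (g ** h) - ?f g - ?f h = F (g, F (h, y)) - F (g, y) - (F (h, y) - y)"
        by simp
      then show ?thesis using mvt[OF that(1) Fy[OF that(2)] yd] by simp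
    qed
    have ah: "approximate_hom \<delta>' H ?f \<epsilon>"
      unfolding approximate_hom_def using multH hom by blast
    have EH: "transvection i j t \<in> H \<and> transvection j i t \<in> H" if "\<bar>t\<bar> \<le> r" for t
      using iso[of t] that r \<delta>' by (simp add: H_def norm_transvection)
    \<comment> \<open>The families \<open>(i, j)\<close> and \<open>(j, i)\<close> are bounded
      together because the estimate for either one uses the bound on both.\<close>
    have "\<forall>t. \<bar>t\<bar> \<le> r \<longrightarrow> norm (?f (transvection i j t)) \<le> 2 * d / 2 ^ N \<and> norm (?f (transvection j i t)) \<le> 2 * d / 2 ^ N" for N
    proof (induction N)
      case 0
      have "norm (?f g) \<le> 2 * d" if "g \<in> H" for g
        using Fy[OF that] yd norm_triangle_ineq4[of "F (g, y) - p" "y - p"] by simp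
      then show ?case using EH by auto
    next
      case (Suc N)
      have half: "K * \<epsilon> * (2 * d / 2 ^ N) \<le> 2 * d / 2 ^ Suc N"
      proof -
        have "K * \<epsilon> * (2 * d / 2 ^ N) \<le> 1 / 2 * (2 * d / 2 ^ N)"
          using \<epsilon>(3) d by (intro mult_right_mono) auto
        then show ?thesis by simp
      qed
      show ?case
      proof (intro allI impI)
        fix t assume t: "\<bar>t\<bar> \<le> r"
        have "norm (?f (transvection i j t)) \<le> K * \<epsilon> * (2 * d / 2 ^ N)"
          by (rule thurston[OF ij t _ _ ah]) (use Suc \<epsilon> EH in auto)
        moreover have "norm (?f (transvection j i t)) \<le> K * \<epsilon> * (2 * d / 2 ^ N)"
          by (rule thurston[OF ij[symmetric] t _ _ ah]) (use Suc \<epsilon> EH in auto)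
        ultimately show "norm (?f (transvection i j t)) \<le> 2 * d / 2 ^ Suc N \<and> norm (?f (transvection j i t)) \<le> 2 * d / 2 ^ Suc N"
          using half by linarith
      qed
    qed
    then have "norm (?f (transvection i j s)) \<le> 2 * d / 2 ^ N" for N using s by blast
    moreover have "(\<lambda>N. 2 * d / 2 ^ N) \<longlonglongrightarrow> 0"
      using tendsto_mult[OF tendsto_const[of "2 * d"] LIMSEQ_inverse_realpow_zero[of 2]] by (simp add: divide_inverse)
    ultimately have "norm (?f (transvection i j s)) \<le> 0"
      by (intro LIMSEQ_le_const) auto
    then show "F (transvection i j s, y) = y" by simp
  qed (use r d in auto)
qed

text \<open>The off-diagonal unit matrices generate the trace zero matrices: the bracket of
  \<open>unit_matrix i j\<close> and \<open>unit_matrix j i\<close> is the difference of two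
  diagonal ones. So \<open>\<rho> y\<close> takes one common value on the diagonal unit matrices,
  and \<open>\<rho> y X\<close> is \<open>trace X\<close> times that value.\<close>

lemma isotropic_imp_stationary_near:
  assumes r0: "r0 > 0" and iso: "\<And>i j s. i \<noteq> j \<Longrightarrow> \<bar>s\<bar> < r0 \<Longrightarrow> isotropic (transvection i j s)"
  obtains d where "d > 0" "\<And>y. y \<in> C \<Longrightarrow> norm (y - p) < d \<Longrightarrow> stationary y"
proof -
  have ev: "\<forall>\<^sub>F y in nhds p. y \<in> C \<longrightarrow> i \<noteq> j \<longrightarrow> \<rho> y (unit_matrix i j) = 0" for i j
  proof (cases "i = j")
    case False
    obtain r d where rd: "r > 0" "d > 0"
      "\<And>y s. y \<in> C \<Longrightarrow> norm (y - p) < d \<Longrightarrow> \<bar>s\<bar> \<le> r \<Longrightarrow> F (transvection i j s, y) = y"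
      by (rule isotropic_imp_fixes_near[OF r0 _ False]) (use iso False in auto)
    have "\<rho> y (unit_matrix i j) = 0" if y: "y \<in> C" "norm (y - p) < d" for y
    proof -
      have "(transvection i j has_vector_derivative unit_matrix i j) (at 0)"
        unfolding transvection_def by (auto simp: has_vector_derivative_def intro!: derivative_eq_intros)
      from curve_derivative[OF this _ y(1)]
      have "((\<lambda>s. F (transvection i j s, y)) has_vector_derivative \<rho> y (unit_matrix i j)) (at 0)" by simp
      then have "((\<lambda>s. y) has_vector_derivative \<rho> y (unit_matrix i j)) (at 0)"
        by (rule has_vector_derivative_transform_within[OF _ rd(1)]) (use rd(3)[OF y] in \<open>auto simp: dist_real_def\<close>)
      then show ?thesis using vector_derivative_unique_at has_vector_derivative_const by blast
    qed
    then show ?thesis using rd(2) unfolding eventually_nhds_metric by (auto simp: dist_norm)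
  qed simp
  have "\<forall>\<^sub>F y in nhds p. \<forall>i j. y \<in> C \<longrightarrow> i \<noteq> j \<longrightarrow> \<rho> y (unit_matrix i j) = 0"
    by (intro eventually_all_finite ev)
  then obtain d where d: "d > 0" "\<And>y i j. norm (y - p) < d \<Longrightarrow> y \<in> C \<Longrightarrow> i \<noteq> j \<Longrightarrow> \<rho> y (unit_matrix i j) = 0"
    unfolding eventually_nhds_metric by (auto simp: dist_norm)
  show ?thesis
  proof (rule that[OF d(1)])
    fix y assume y: "y \<in> C" "norm (y - p) < d"
    have off: "\<rho> y (unit_matrix i j) = 0" if "i \<noteq> j" for i j using d y that by blast
    have diag: "\<rho> y (unit_matrix i i) = \<rho> y (unit_matrix j j)" for i j
    proof (cases "i = j")
      case False
      have "\<rho> y (unit_matrix i j ** unit_matrix j i - unit_matrix j i ** unit_matrix i j) = 0"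
        unfolding unit_matrix_def
        by (rule \<rho>_bracket[OF y(1)]) (use off[OF False] off[OF False[symmetric]] False in
            \<open>simp_all add: unit_matrix_def[symmetric]\<close>, simp_all add: inner_axis_axis trace_outer unit_matrix_def)
      then show ?thesis by (simp add: unit_matrix_mult linear_diff[OF linear_\<rho>])
    qed simp
    show "stationary y"
      unfolding stationary_def
    proof (intro allI impI)
      fix X :: "real^'m^'m" assume X: "trace X = 0"
      obtain i0 :: 'm where True by simp
      have "X = (\<Sum>i\<in>UNIV. \<Sum>j\<in>UNIV. X $ i $ j *\<^sub>R unit_matrix i j)"
        by (simp add: vec_eq_iff unit_matrix_def axis_def if_distrib[of "\<lambda>x. _ * x"] if_distrib[of "\<lambda>x. x * _"] cong: if_cong)
      then have "\<rho> y X = \<rho> y (\<Sum>i\<in>UNIV. \<Sum>j\<in>UNIV. X $ i $ j *\<^sub>R unit_matrix i j)" by simp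
      also have "\<dots> = (\<Sum>i\<in>UNIV. \<Sum>j\<in>UNIV. X $ i $ j *\<^sub>R \<rho> y (unit_matrix i j))"
        by (simp add: linear_sum[OF linear_\<rho>] linear_cmul[OF linear_\<rho>])
      also have "\<dots> = (\<Sum>i\<in>UNIV. \<Sum>j\<in>UNIV. if j = i then X $ i $ i *\<^sub>R \<rho> y (unit_matrix i0 i0) else 0)"
        by (intro sum.cong refl) (use off diag in auto)
      also have "\<dots> = trace X *\<^sub>R \<rho> y (unit_matrix i0 i0)"
        by (simp add: trace_def scaleR_sum_left)
      finally show "\<rho> y X = 0" using X by simp
    qed
  qed
qed

lemma boundary_stationary_near:
  assumes "p $ k = 0"
  obtains d where "d > 0" "\<And>y. y \<in> C \<Longrightarrow> norm (y - p) < d \<Longrightarrow> stationary y"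
proof -
  obtain r where "r > 0" "\<And>i j s. i \<noteq> j \<Longrightarrow> \<bar>s\<bar> < r \<Longrightarrow> isotropic (transvection i j s)"
    using boundary_isotropic[OF assms] by blast
  from isotropic_imp_stationary_near[OF this] that show ?thesis by blast
qed

text \<open>By the uniform radius of \<open>stationary_fixed\<close>, a given \<open>g\<close> near
  the identity fixes whole neighbourhoods of points converging to \<open>p\<close>. There its
  derivative is the identity, and continuity of \<open>F'\<close> passes this on to
  \<open>p\<close>.\<close>

lemma stationary_near_limit:
  assumes lim: "\<And>c. c > 0 \<Longrightarrow> \<exists>y\<in>C. norm (y - p) < c \<and> (\<exists>d>0. \<forall>z\<in>C. norm (z - y) < d \<longrightarrow> stationary z)"
  obtains d where "d > 0" "\<And>y. y \<in> C \<Longrightarrow> norm (y - p) < d \<Longrightarrow> stationary y"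
proof -
  obtain \<eta> where \<eta>: "\<eta> > 0" "\<eta> \<le> \<delta>"
    "\<And>y g. y \<in> C \<Longrightarrow> stationary y \<Longrightarrow> det g = 1 \<Longrightarrow> norm (g - mat 1) < \<eta> \<Longrightarrow> F (g, y) = y"
    using stationary_fixed by blast
  have "isotropic g" if g: "det g = 1" "norm (g - mat 1) < \<eta>" for g
  proof -
    have gB: "g \<in> B" using g \<eta> by (simp add: B_def)
    have "\<exists>y. y \<in> C \<and> norm (y - p) < inverse (real (Suc n)) \<and> F (g, y) = y \<and> (\<forall>v. D g y v = v)" for n
    proof -
      obtain y d where y: "y \<in> C" "norm (y - p) < inverse (real (Suc n))" and d: "d > 0"
        "\<And>z. z \<in> C \<Longrightarrow> norm (z - y) < d \<Longrightarrow> stationary z"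
        using lim[of "inverse (real (Suc n))"] by auto
      have fix_z: "F (g, z) = z" if "z \<in> C" "norm (z - y) < d" for z
        using \<eta>(3)[OF that(1) d(2)[OF that] g] .
      show ?thesis using y fix_z[OF y(1)] d(1) D_eq_id[OF gB y(1) d(1) fix_z] by auto
    qed
    then obtain Y where Y: "\<And>n. Y n \<in> C" "\<And>n. norm (Y n - p) < inverse (real (Suc n))"
      "\<And>n. F (g, Y n) = Y n" "\<And>n v. D g (Y n) v = v" by metis
    have lim: "Y \<longlonglongrightarrow> p"
      by (rule LIM_zero_cancel, rule Lim_null_comparison[OF _ LIMSEQ_inverse_real_of_nat])
        (use Y(2) in \<open>auto intro!: always_eventually less_imp_le\<close>)
    have "(\<lambda>n. F (g, Y n)) \<longlonglongrightarrow> F (g, p)" by (rule tendsto_F[OF gB p_C tendsto_const lim])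
    then have 1: "F (g, p) = p" using lim Y(3) LIMSEQ_unique by simp
    have "D g p v = v" for v
    proof -
      have "(\<lambda>n. F' (g, Y n)) \<longlonglongrightarrow> F' (g, p)"
        by (rule continuous_on_tendsto_compose[OF cont tendsto_Pair[OF tendsto_const lim]])
          (use Y(1) gB e in \<open>auto simp: B_def C_def\<close>)
      then have "(\<lambda>n. D g (Y n) v) \<longlonglongrightarrow> D g p v"
        unfolding D_def by (intro blinfun.tendsto tendsto_const)
      then show ?thesis by (simp add: Y(4) LIMSEQ_const_iff)
    qed
    with 1 gB show ?thesis by (simp add: isotropic_def)
  qed
  then have "isotropic (transvection i j s)" if "i \<noteq> j" "\<bar>s\<bar> < \<eta>" for i j s
    using that by (simp add: det_transvection norm_transvection)
  from isotropic_imp_stationary_near[OF \<eta>(1) this] that show ?thesis by blast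
qed

lemma fixed_imp_stationary:
  assumes y: "y \<in> C" and \<eta>: "\<eta> > 0" "\<And>g. det g = 1 \<Longrightarrow> norm (g - mat 1) < \<eta> \<Longrightarrow> F (g, y) = y"
  shows "stationary y"
  unfolding stationary_def
proof (intro allI impI)
  fix X :: "real^'m^'m" assume "trace X = 0"
  then obtain h where h: "h 0 = mat 1" "(h has_vector_derivative X) (at 0)" "\<forall>\<^sub>F t in at 0. det (h t) = 1"
    using unimodular_curve by blast
  have "((\<lambda>s. norm (h s - mat 1)) \<longlongrightarrow> norm (h 0 - mat 1)) (at 0)"
    using has_vector_derivative_continuous[OF h(2)] by (intro tendsto_intros) (simp add: isCont_def)
  then have "\<forall>\<^sub>F s in at 0. norm (h s - mat 1) < \<eta>"
    by (rule order_tendstoD) (use \<eta>(1) h(1) in simp)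
  with h(3) have "\<forall>\<^sub>F s in at 0. F (h s, y) = y"
    by eventually_elim (rule \<eta>(2))
  then obtain d where d: "d > 0" "\<And>s. s \<noteq> 0 \<Longrightarrow> dist s 0 < d \<Longrightarrow> F (h s, y) = y"
    unfolding eventually_at by auto
  have "F (h s, y) = y" if "dist s 0 < d" for s
    using d(2) that h(1) y by (cases "s = 0") auto
  then have "((\<lambda>s. y) has_vector_derivative \<rho> y X) (at 0)"
    by (intro has_vector_derivative_transform_within[OF curve_derivative[OF h(2,1) y] d(1)]) auto
  then show "\<rho> y X = 0" using vector_derivative_unique_at has_vector_derivative_const by blast
qed

end

section \<open>Local actions on manifolds\<close>

text \<open>Being defined is part of the condition. The radius may vary with \<open>x\<close>;
  passing to \<open>stationary\<close> in a chart makes it locally uniform.\<close>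

definition locally_fixed :: "(real^'m^'m \<Rightarrow> 'a \<rightharpoonup> 'a) \<Rightarrow> 'a \<Rightarrow> bool" where
  "locally_fixed \<alpha> x \<longleftrightarrow> (\<exists>\<eta>>0. \<forall>g. det g = 1 \<longrightarrow> norm (g - mat 1) < \<eta> \<longrightarrow> \<alpha> g x = Some x)"

lemma C1_local_actionD:
  assumes "C1_local_action M A G \<alpha>"
  shows "g \<in> G \<Longrightarrow> C1_partial_diffeo M A (\<alpha> g)"
    and "g \<in> G \<Longrightarrow> h \<in> G \<Longrightarrow> \<alpha> h x = Some y \<Longrightarrow> \<alpha> g y = Some z \<Longrightarrow> \<alpha> (g ** h) x = Some w \<Longrightarrow> z = w"
    and "openin (prod_topology (top_of_set G) M) (action_domain G \<alpha>)"
    and "{mat 1} \<times> topspace M \<subseteq> action_domain G \<alpha>"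
    and "C1_evaluation M A G \<alpha>"
proof -
  note * = assms[unfolded C1_local_action_def]
  show "g \<in> G \<Longrightarrow> C1_partial_diffeo M A (\<alpha> g)" using * [THEN conjunct1] by (rule bspec)
  show "g \<in> G \<Longrightarrow> h \<in> G \<Longrightarrow> \<alpha> h x = Some y \<Longrightarrow> \<alpha> g y = Some z \<Longrightarrow> \<alpha> (g ** h) x = Some w \<Longrightarrow> z = w"
    using * [THEN conjunct2, THEN conjunct1, rule_format, of g h x y z w] by simp
qed (use assms in \<open>simp_all only: C1_local_action_def\<close>)

lemma local_action_mat_1:
  fixes M :: "'a topology" and A :: "('a, 'n::finite) chart set" and \<alpha> :: "real^'m^'m \<Rightarrow> 'a \<rightharpoonup> 'a"
  assumes action: "C1_local_action M A SL0 \<alpha>" and x: "x \<in> topspace M"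
  shows "\<alpha> (mat 1) x = Some x"
proof -
  have dom: "\<And>z. z \<in> topspace M \<Longrightarrow> z \<in> dom (\<alpha> (mat 1))"
    using C1_local_actionD(4)[OF action] by (auto simp: action_domain_def)
  have pd: "C1_partial_diffeo M A (\<alpha> (mat 1))"
    by (rule C1_local_actionD(1)[OF action mat_1_in_SL0])
  obtain y where y: "\<alpha> (mat 1) x = Some y" using dom[OF x] by auto
  have "y \<in> ran (\<alpha> (mat 1))" using y by (auto simp: ran_def)
  then have yM: "y \<in> topspace M"
    using pd openin_subset unfolding C1_partial_diffeo_def by blast
  obtain z where z: "\<alpha> (mat 1) y = Some z" using dom[OF yM] by auto
  have "\<alpha> (mat 1 ** mat 1) x = Some y" using y by simp
  then have "z = y" by (rule C1_local_actionD(2)[OF action mat_1_in_SL0 mat_1_in_SL0 y z])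
  moreover have "inj_on (\<alpha> (mat 1)) (dom (\<alpha> (mat 1)))"
    using pd unfolding C1_partial_diffeo_def by blast
  ultimately have "x = y" using y z dom[OF x] dom[OF yM] inj_onD[of "\<alpha> (mat 1)" "dom (\<alpha> (mat 1))" x y] by simp
  with y show ?thesis by simp
qed

section \<open>Passing to a chart\<close>

lemma chart_image_open:
  assumes c: "is_chart k M (U, \<phi>)" and V: "openin M V" "V \<subseteq> U"
  shows "openin (top_of_set (half_space k)) (\<phi> ` V)"
proof -
  have h: "openin M U" "openin (top_of_set (half_space k)) (\<phi> ` U)"
    "homeomorphic_map (subtopology M U) (top_of_set (\<phi> ` U)) \<phi>"
    using c by (auto simp: is_chart_def)
  have "openin (subtopology M U) V" using V by (auto simp: openin_subtopology)
  then have "openin (top_of_set (\<phi> ` U)) (\<phi> ` V)"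
    using homeomorphic_imp_open_map[OF h(3)] by (simp add: open_map_def)
  then show ?thesis using h(2) openin_trans by blast
qed

lemma chart_preimage_open:
  assumes c: "is_chart k M (U, \<phi>)" and T: "open T"
  shows "openin M {z \<in> U. \<phi> z \<in> T}"
proof -
  have h: "openin M U" "homeomorphic_map (subtopology M U) (top_of_set (\<phi> ` U)) \<phi>"
    using c by (auto simp: is_chart_def)
  have "continuous_map (subtopology M U) euclidean \<phi>"
    using homeomorphic_imp_continuous_map[OF h(2)] continuous_map_into_fulltopology by blast
  then have "openin (subtopology M U) {z \<in> topspace (subtopology M U). \<phi> z \<in> T}"
    by (rule openin_continuous_map_preimage) (use T in simp)
  moreover have "topspace (subtopology M U) = U" using openin_subset[OF h(1)] by auto
  ultimately have "openin (subtopology M U) {z \<in> U. \<phi> z \<in> T}" by (simp only:)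
  then show ?thesis using h(1) by (rule openin_trans_full)
qed

lemma chart_inj: "is_chart k M (U, \<phi>) \<Longrightarrow> inj_on \<phi> U"
  using homeomorphic_imp_injective_map[of "subtopology M U" _ \<phi>] openin_subset[of M U]
  by (auto simp: is_chart_def Int_absorb1)

text \<open>\<open>F\<close> is the C1 extension of the coordinate form of the evaluation map around
  \<open>(mat 1, \<phi> x)\<close>. On a small box every point of the half-space comes from a point
  of \<open>U\<close> that the action keeps in \<open>U\<close>, and injectivity of
  \<open>\<phi>\<close> transfers the group law.\<close>

lemma local_model:
  fixes M :: "'a topology" and A :: "('a, 'n::finite) chart set" and \<alpha> :: "real^'m^'m \<Rightarrow> 'a \<rightharpoonup> 'a"
  assumes dim: "CARD('m::finite) = CARD('n) + 1" and atlas: "analytic_atlas k M A"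
    and action: "C1_local_action M A SL0 \<alpha>" and c: "(U, \<phi>) \<in> A" and x: "x \<in> U"
  obtains F F' \<delta> e where "local_SL_action k (\<phi> x) F F' \<delta> e"
    "\<And>g y. det g = 1 \<Longrightarrow> norm (g - mat 1) < \<delta> \<Longrightarrow> y \<in> half_space k \<Longrightarrow> norm (y - \<phi> x) < e \<Longrightarrow>
      \<exists>v\<in>U. \<exists>z\<in>U. \<phi> v = y \<and> \<alpha> g v = Some z \<and> \<phi> z = F (g, y)"
proof -
  let ?\<psi> = "inv_into U \<phi>"
  have chart: "is_chart k M (U, \<phi>)" using atlas c unfolding analytic_atlas_def by blast
  have UM: "openin M U" using chart by (simp add: is_chart_def)
  have \<phi>U: "\<phi> ` U \<subseteq> half_space k"
    using chart openin_subset unfolding is_chart_def by fastforce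
  have inj: "inj_on \<phi> U" using chart by (rule chart_inj)
  have id: "\<alpha> (mat 1) z = Some z" if "z \<in> U" for z
    using local_action_mat_1[OF action] that openin_subset[OF UM] by blast
  let ?Om = "action_domain SL0 \<alpha>" and ?P = "prod_topology (top_of_set (SL0 :: (real^'m^'m) set)) M"
  let ?ev = "\<lambda>(g, x). the (\<alpha> g x)"
  have ev: "C1_evaluation M A SL0 \<alpha>" and Om: "openin ?P ?Om"
    by (rule C1_local_actionD[OF action])+
  define S where "S = {(g, \<phi> x) | g x. (g, x) \<in> ?Om \<and> x \<in> U \<and> the (\<alpha> g x) \<in> U}"
  define f where "f = (\<lambda>(g, y). \<phi> (the (\<alpha> g (?\<psi> y))))"
  have C1: "C1_on_set f S"
    unfolding f_def S_def
    using bspec[OF bspec[OF conjunct2[OF ev[unfolded C1_evaluation_def]] c, unfolded prod.case] c]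
    by simp
  have mem: "(mat 1, \<phi> x) \<in> S"
    unfolding S_def using id[OF x] x mat_1_in_SL0 by (auto simp: action_domain_def)
  obtain W F F' where *: "open W \<and> (mat 1, \<phi> x) \<in> W \<and>
      (\<forall>q\<in>W. (F has_derivative blinfun_apply (F' q)) (at q)) \<and> continuous_on W F' \<and> (\<forall>q\<in>W \<inter> S. F q = f q)"
    using bspec[OF C1[unfolded C1_on_set_def] mem] by (elim exE) (rule that)
  then have W: "open W" "(mat 1, \<phi> x) \<in> W" and F': "continuous_on W F'"
    by simp_all
  have F: "(F has_derivative blinfun_apply (F' q)) (at q)" if "q \<in> W" for q
    using * that by simp
  have Ff: "F q = f q" if "q \<in> W" "q \<in> S" for q
    using * that by simp
  obtain w where w: "w > 0" "ball (mat 1, \<phi> x) w \<subseteq> W" using W openE by blast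
  have inW: "(g, y) \<in> W" if "norm (g - mat 1) < w / 2" "norm (y - \<phi> x) < w / 2" for g y
  proof -
    have "norm ((g, y) - (mat 1, \<phi> x)) \<le> norm (g - mat 1) + norm (y - \<phi> x)"
      using norm_Pair_le[of "g - mat 1" "y - \<phi> x"] by simp
    then have "dist (g, y) (mat 1, \<phi> x) < w" using that unfolding dist_norm by linarith
    then have "(g, y) \<in> ball (mat 1, \<phi> x) w" by (simp add: dist_commute)
    with w show ?thesis by blast
  qed
  let ?Om' = "{q \<in> ?Om. snd q \<in> U \<and> ?ev q \<in> U}"
  have cm: "continuous_map (subtopology ?P ?Om) M ?ev" using ev by (simp add: C1_evaluation_def)
  have "topspace (subtopology ?P ?Om) = ?Om" using openin_subset[OF Om] by auto
  then have "openin ?P {q \<in> ?Om. ?ev q \<in> U}"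
    using openin_trans_full[OF openin_continuous_map_preimage[OF cm UM] Om] by (simp only:)
  moreover have "openin ?P (SL0 \<times> U)" using UM by (simp add: openin_prod_Times_iff)
  ultimately have "openin ?P ({q \<in> ?Om. ?ev q \<in> U} \<inter> (SL0 \<times> U))" by (simp add: openin_Int)
  moreover have "{q \<in> ?Om. ?ev q \<in> U} \<inter> (SL0 \<times> U) = ?Om'" by (auto simp: action_domain_def)
  ultimately have Om': "openin ?P ?Om'" by simp
  have mem': "(mat 1, x) \<in> ?Om'" using id[OF x] x mat_1_in_SL0 by (auto simp: action_domain_def)
  obtain N V where "openin (top_of_set SL0) N \<and> openin M V \<and> mat 1 \<in> N \<and> x \<in> V \<and> N \<times> V \<subseteq> ?Om'"
    using Om'[unfolded openin_prod_topology_alt, rule_format, OF mem'] by (elim exE) (rule that)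
  then have NV: "openin (top_of_set SL0) N" "openin M V" "mat 1 \<in> N" "x \<in> V" "N \<times> V \<subseteq> ?Om'"
    by simp_all
  have VU: "V \<subseteq> U" using NV by auto
  obtain n where n: "n > 0" "\<And>g. g \<in> SL0 \<Longrightarrow> dist g (mat 1) < n \<Longrightarrow> g \<in> N"
    using NV(1,3) unfolding openin_euclidean_subtopology_iff by blast
  have "openin (top_of_set (half_space k)) (\<phi> ` V)" by (rule chart_image_open[OF chart NV(2) VU])
  then obtain b where b: "b > 0" "\<And>y. y \<in> half_space k \<Longrightarrow> dist y (\<phi> x) < b \<Longrightarrow> y \<in> \<phi> ` V"
    using NV(4) unfolding openin_euclidean_subtopology_iff by blast
  obtain s where s: "s > 0" "\<And>g :: real^'m^'m. det g = 1 \<Longrightarrow> norm (g - mat 1) < s \<Longrightarrow> g \<in> SL0"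
    using SL0_near_mat_1 by blast
  \<comment> \<open>The bound \<open>w / 2\<close> on each component keeps pairs in
    \<open>W\<close>, \<open>n\<close> keeps \<open>g\<close> in \<open>N\<close>, and
    \<open>s\<close> keeps it in \<open>SL0\<close>.\<close>
  define \<delta> where "\<delta> = min (min (w / 2) n) s"
  define e where "e = min (w / 2) b"
  have model: "\<exists>v\<in>U. \<exists>z\<in>U. \<phi> v = y \<and> \<alpha> g v = Some z \<and> \<phi> z = F (g, y)"
    if gy: "det g = 1" "norm (g - mat 1) < \<delta>" "y \<in> half_space k" "norm (y - \<phi> x) < e" for g y
  proof -
    have g: "g \<in> N" using that s n by (auto simp: \<delta>_def dist_norm)
    obtain v where v: "v \<in> V" "y = \<phi> v" using b(2)[of y] gy by (auto simp: e_def dist_norm)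
    have q: "(g, v) \<in> ?Om'" using g v NV by blast
    then obtain z where z: "\<alpha> g v = Some z" "z \<in> U" by (auto simp: action_domain_def)
    have "(g, y) \<in> S" unfolding S_def using q v by auto
    then have "F (g, y) = f (g, y)"
      using Ff inW that by (simp add: \<delta>_def e_def)
    also have "\<dots> = \<phi> z" using z v VU inj by (auto simp: f_def)
    finally show ?thesis using z v VU by auto
  qed
  have SL: "g \<in> SL0" if "det g = 1" "norm (g - mat 1) < \<delta>" for g :: "real^'m^'m"
    using s that by (simp add: \<delta>_def)
  have pos: "\<delta> > 0" "e > 0" using w n s b by (auto simp: \<delta>_def e_def)
  have "local_SL_action k (\<phi> x) F F' \<delta> e"
  proof
    show "CARD('m) = CARD('n) + 1" by fact
    show "\<delta> > 0" "e > 0" by fact+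
    show "\<phi> x \<in> half_space k" using \<phi>U x by auto
    show "(F has_derivative blinfun_apply (F' (g, y))) (at (g, y))"
      if "norm (g - mat 1) < \<delta>" "norm (y - \<phi> x) < e" for g y
      using F inW that by (simp add: \<delta>_def e_def)
    show "continuous_on {(g, y). norm (g - mat 1) < \<delta> \<and> norm (y - \<phi> x) < e} F'"
      by (rule continuous_on_subset[OF F']) (use inW in \<open>auto simp: \<delta>_def e_def\<close>)
    show "F (g, y) \<in> half_space k"
      if "det g = 1" "norm (g - mat 1) < \<delta>" "y \<in> half_space k" "norm (y - \<phi> x) < e" for g y
      using model[OF that] \<phi>U by (metis image_subset_iff)
    show "F (mat 1, y) = y" if y: "y \<in> half_space k" "norm (y - \<phi> x) < e" for y
    proof -
      obtain v z where "v \<in> U" "\<phi> v = y" "\<alpha> (mat 1) v = Some z" "\<phi> z = F (mat 1, y)"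
        using model[of "mat 1" y] y pos by auto
      then show ?thesis using id[of v] by simp
    qed
    show "F (g, F (h, y)) = F (g ** h, y)"
      if d: "det g = 1" "det h = 1" and n: "norm (g - mat 1) < \<delta>" "norm (h - mat 1) < \<delta>"
        "norm (g ** h - mat 1) < \<delta>" and y: "y \<in> half_space k" "norm (y - \<phi> x) < e" "norm (F (h, y) - \<phi> x) < e" for g h y
    proof -
      obtain v z where v: "v \<in> U" "z \<in> U" "\<phi> v = y" "\<alpha> h v = Some z" "\<phi> z = F (h, y)"
        using model[OF d(2) n(2) y(1,2)] by blast
      have "F (h, y) \<in> half_space k" using v \<phi>U by (metis image_subset_iff)
      then obtain z' u where u: "z' \<in> U" "\<phi> z' = F (h, y)" "\<alpha> g z' = Some u" "\<phi> u = F (g, F (h, y))"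
        using model[OF d(1) n(1) _ y(3)] by blast
      have "z' = z" using u v inj by (metis inj_onD)
      have "det (g ** h) = 1" using that by (simp add: det_mul)
      then obtain v' t where t: "v' \<in> U" "\<phi> v' = y" "\<alpha> (g ** h) v' = Some t" "\<phi> t = F (g ** h, y)"
        using model[OF _ n(3) y(1,2)] by blast
      have "v' = v" using t v inj by (metis inj_onD)
      have "u = t"
        using C1_local_actionD(2)[OF action SL[OF that(1) n(1)] SL[OF that(2) n(2)] v(4), of u t] u t
          \<open>z' = z\<close> \<open>v' = v\<close> by simp
      then show ?thesis using u t by simp
    qed
  qed
  with model that show ?thesis by blast
qed

lemma locally_fixed_all:
  fixes k :: "'n::finite" and M :: "'a topology" and A :: "('a, 'n) chart set" and \<alpha> :: "real^'m^'m \<Rightarrow> 'a \<rightharpoonup> 'a"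
  assumes dim: "CARD('m::finite) = CARD('n) + 1"
    and manifold: "analytic_manifold_with_boundary k M A"
    and boundary: "manifold_boundary k A \<noteq> {}"
    and action: "C1_local_action M A SL0 \<alpha>"
    and x: "x \<in> topspace M"
  shows "locally_fixed \<alpha> x"
proof -
  have atlas: "analytic_atlas k M A" and con: "connected_space M"
    using manifold by (auto simp: analytic_manifold_with_boundary_def)
  define Z where "Z = {x \<in> topspace M. locally_fixed \<alpha> x}"
  let ?Z = "M interior_of Z"
  \<comment> \<open>Both the existence of an interior point of \<open>Z\<close> and its closedness
    are reduced to stationarity near the coordinates of a point.\<close>
  have int: "a \<in> ?Z" if c: "(U, \<phi>) \<in> A" "a \<in> U" and lm: "local_SL_action k (\<phi> a) F F' \<delta> e"
    and model: "\<And>g y. det g = 1 \<Longrightarrow> norm (g - mat 1) < \<delta> \<Longrightarrow> y \<in> half_space k \<Longrightarrow> norm (y - \<phi> a) < e \<Longrightarrow>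
      \<exists>v\<in>U. \<exists>z\<in>U. \<phi> v = y \<and> \<alpha> g v = Some z \<and> \<phi> z = F (g, y)"
    and d: "d > 0" "\<And>y. y \<in> local_SL_action.C k (\<phi> a) e \<Longrightarrow> norm (y - \<phi> a) < d \<Longrightarrow> local_SL_action.stationary F' y"
    for a U \<phi> F F' \<delta> e d
  proof -
    interpret local_SL_action k "\<phi> a" F F' \<delta> e by (rule lm)
    have chart: "is_chart k M (U, \<phi>)" using atlas c unfolding analytic_atlas_def by blast
    have inj: "inj_on \<phi> U" using chart by (rule chart_inj)
    have \<phi>U: "\<phi> ` U \<subseteq> half_space k" using chart openin_subset unfolding is_chart_def by fastforce
    obtain \<eta> where \<eta>: "\<eta> > 0" "\<eta> \<le> \<delta>"
      "\<And>y g. y \<in> C \<Longrightarrow> stationary y \<Longrightarrow> det g = 1 \<Longrightarrow> norm (g - mat 1) < \<eta> \<Longrightarrow> F (g, y) = y"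
      using stationary_fixed by blast
    let ?V = "{z \<in> U. \<phi> z \<in> ball (\<phi> a) (min d e)}"
    have "openin M ?V" by (rule chart_preimage_open[OF chart]) simp
    moreover have "?V \<subseteq> Z"
    proof
      fix z assume z: "z \<in> ?V"
      then have zC: "\<phi> z \<in> C" "norm (\<phi> z - \<phi> a) < d"
        using \<phi>U by (auto simp: C_def dist_norm norm_minus_commute)
      have "\<alpha> g z = Some z" if g: "det g = 1" "norm (g - mat 1) < \<eta>" for g
      proof -
        obtain v u where "v \<in> U" "u \<in> U" "\<phi> v = \<phi> z" "\<alpha> g v = Some u" "\<phi> u = F (g, \<phi> z)"
          using model[of g "\<phi> z"] g \<eta> zC by (auto simp: C_def)
        moreover have "F (g, \<phi> z) = \<phi> z" by (rule \<eta>(3)[OF zC(1) d(2)[OF zC] g])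
        ultimately show ?thesis using z inj by (auto dest: inj_onD)
      qed
      moreover have "z \<in> topspace M" using z openin_subset[of M U] chart by (auto simp: is_chart_def)
      ultimately show "z \<in> Z" using \<eta>(1) by (auto simp: Z_def locally_fixed_def)
    qed
    moreover have "a \<in> ?V" using c d(1) e by simp
    ultimately show ?thesis unfolding interior_of_def by blast
  qed
  have "?Z \<noteq> {}"
  proof -
    obtain b U \<phi> where b: "(U, \<phi>) \<in> A" "b \<in> U" "\<phi> b $ k = 0"
      using boundary by (auto simp: manifold_boundary_def)
    obtain F F' \<delta> e where lm: "local_SL_action k (\<phi> b) F F' \<delta> e" and
      model: "\<And>g y. det g = 1 \<Longrightarrow> norm (g - mat 1) < \<delta> \<Longrightarrow> y \<in> half_space k \<Longrightarrow> norm (y - \<phi> b) < e \<Longrightarrow>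
      \<exists>v\<in>U. \<exists>z\<in>U. \<phi> v = y \<and> \<alpha> g v = Some z \<and> \<phi> z = F (g, y)"
      using local_model[OF dim atlas action b(1,2)] by blast
    obtain d where d: "d > 0"
      "\<And>y. y \<in> local_SL_action.C k (\<phi> b) e \<Longrightarrow> norm (y - \<phi> b) < d \<Longrightarrow> local_SL_action.stationary F' y"
      using local_SL_action.boundary_stationary_near[OF lm b(3)] by blast
    have "b \<in> ?Z" by (rule int[OF b(1,2) lm model d])
    then show ?thesis by blast
  qed
  moreover have "closedin M ?Z"
  proof -
    have "M closure_of ?Z \<subseteq> ?Z"
    proof
      fix a assume a: "a \<in> M closure_of ?Z"
      then have aM: "a \<in> topspace M" by (simp add: in_closure_of)
      obtain U \<phi> where c: "(U, \<phi>) \<in> A" "a \<in> U"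
        using atlas aM unfolding analytic_atlas_def by blast
      have chart: "is_chart k M (U, \<phi>)" using atlas c unfolding analytic_atlas_def by blast
      have inj: "inj_on \<phi> U" using chart by (rule chart_inj)
      have UM: "openin M U" using chart by (simp add: is_chart_def)
      have \<phi>U: "\<phi> ` U \<subseteq> half_space k" using chart openin_subset unfolding is_chart_def by fastforce
      obtain F F' \<delta> e where lm: "local_SL_action k (\<phi> a) F F' \<delta> e" and
        model: "\<And>g y. det g = 1 \<Longrightarrow> norm (g - mat 1) < \<delta> \<Longrightarrow> y \<in> half_space k \<Longrightarrow> norm (y - \<phi> a) < e \<Longrightarrow>
          \<exists>v\<in>U. \<exists>z\<in>U. \<phi> v = y \<and> \<alpha> g v = Some z \<and> \<phi> z = F (g, y)"
        using local_model[OF dim atlas action c] by blast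
      interpret local_SL_action k "\<phi> a" F F' \<delta> e by (rule lm)
      have lim: "\<exists>y\<in>C. norm (y - \<phi> a) < b \<and> (\<exists>d>0. \<forall>z\<in>C. norm (z - y) < d \<longrightarrow> stationary z)" if b: "b > 0" for b
      proof -
        let ?V = "{z \<in> U. \<phi> z \<in> ball (\<phi> a) (min b e)}"
        have V: "openin M ?V" by (rule chart_preimage_open[OF chart]) simp
        have aV: "a \<in> ?V" using c b e by simp
        obtain z where z: "z \<in> ?V" "z \<in> ?Z"
          using a[unfolded in_closure_of, THEN conjunct2, THEN spec, of ?V] V aV by blast
        have "openin (top_of_set (half_space k)) (\<phi> ` (U \<inter> ?Z))"
          by (rule chart_image_open[OF chart]) (use UM in auto)
        then obtain d where d: "d > 0" "\<And>y. y \<in> half_space k \<Longrightarrow> dist y (\<phi> z) < d \<Longrightarrow> y \<in> \<phi> ` (U \<inter> ?Z)"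
          using z unfolding openin_euclidean_subtopology_iff by blast
        \<comment> \<open>The radius in \<open>locally_fixed\<close> depends on \<open>v\<close>,
          but stationarity at \<open>y\<close> is an infinitesimal condition, for which any positive
          radius suffices.\<close>
        have "stationary y" if y: "y \<in> C" "norm (y - \<phi> z) < d" for y
        proof -
          obtain v where v: "v \<in> U" "v \<in> ?Z" "y = \<phi> v"
            using d(2)[of y] y by (auto simp: C_def dist_norm)
          then have "locally_fixed \<alpha> v" using interior_of_subset[of M Z] by (auto simp: Z_def)
          then obtain \<eta> where \<eta>: "\<eta> > 0" "\<And>g. det g = 1 \<Longrightarrow> norm (g - mat 1) < \<eta> \<Longrightarrow> \<alpha> g v = Some v"
            by (auto simp: locally_fixed_def)
          show ?thesis
          proof (rule fixed_imp_stationary[OF y(1), of "min \<eta> \<delta>"])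
            show "min \<eta> \<delta> > 0" using \<eta> \<delta> by simp
            fix g :: "real^'m^'m" assume g: "det g = 1" "norm (g - mat 1) < min \<eta> \<delta>"
            obtain v' u where u: "v' \<in> U" "\<phi> v' = y" "\<alpha> g v' = Some u" "\<phi> u = F (g, y)"
              using model[of g y] g y by (auto simp: C_def)
            have "v' = v" using u v inj by (metis inj_onD)
            then show "F (g, y) = y" using u v \<eta>(2)[of g] g by simp
          qed
        qed
        moreover have "\<phi> z \<in> C" "norm (\<phi> z - \<phi> a) < b"
          using z \<phi>U by (auto simp: C_def dist_norm norm_minus_commute)
        ultimately show ?thesis using d(1) by blast
      qed
      obtain d where d: "d > 0" "\<And>y. y \<in> C \<Longrightarrow> norm (y - \<phi> a) < d \<Longrightarrow> stationary y"
        using stationary_near_limit[OF lim] by blast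
      show "a \<in> ?Z" by (rule int[OF c lm model d])
    qed
    then show ?thesis
      using closure_of_subset_eq[of ?Z M] interior_of_subset_topspace[of M Z] by simp
  qed
  ultimately have "?Z = topspace M"
    using con openin_interior_of unfolding connected_space_clopen_in by blast
  then show ?thesis using x interior_of_subset[of M Z] by (auto simp: Z_def)
qed

text \<open>Within the component, the set of \<open>g\<close> fixing \<open>x\<close> is closed
  because points are closed in \<open>M\<close>. It is open because a nearby \<open>g\<close> is
  \<open>(g ** matrix_inv g0) ** g0\<close>, with both factors fixing \<open>x\<close>; the group
  law determines \<open>\<alpha> g x\<close>, as this is defined on the slice.\<close>

lemma slice_component_fixed:
  fixes M :: "'a topology" and A :: "('a, 'n::finite) chart set" and \<alpha> :: "real^'m^'m \<Rightarrow> 'a \<rightharpoonup> 'a"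
  assumes hausdorff: "Hausdorff_space M" and action: "C1_local_action M A SL0 \<alpha>"
    and x: "x \<in> topspace M" and fixed: "locally_fixed \<alpha> x"
    and g: "g \<in> connected_component_set (group_slice SL0 \<alpha> x) (mat 1)"
  shows "\<alpha> g x = Some x"
proof -
  let ?S = "connected_component_set (group_slice SL0 \<alpha> x) (mat 1)"
  let ?Om = "action_domain SL0 \<alpha>"
  let ?T = "{g \<in> ?S. the (\<alpha> g x) = x}"
  have sub: "?S \<subseteq> group_slice SL0 \<alpha> x" by (rule connected_component_subset)
  have dom: "\<exists>z. \<alpha> g x = Some z" "g \<in> SL0" if "g \<in> ?S" for g
    using subsetD[OF sub that] by (auto simp: group_slice_def)
  have ev: "C1_evaluation M A SL0 \<alpha>"
    by (rule C1_local_actionD[OF action])+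
  have "continuous_map (top_of_set ?S) (prod_topology (top_of_set SL0) M) (\<lambda>g. (g, x))"
    using dom(2) x by (auto simp: continuous_map_paired continuous_map_in_subtopology)
  then have "continuous_map (top_of_set ?S) (subtopology (prod_topology (top_of_set SL0) M) ?Om) (\<lambda>g. (g, x))"
    using dom by (auto simp: continuous_map_in_subtopology action_domain_def)
  moreover have "continuous_map (subtopology (prod_topology (top_of_set SL0) M) ?Om) M (\<lambda>(g, x). the (\<alpha> g x))"
    using ev by (simp add: C1_evaluation_def)
  ultimately have "continuous_map (top_of_set ?S) M ((\<lambda>(g, x). the (\<alpha> g x)) \<circ> (\<lambda>g. (g, x)))"
    by (rule continuous_map_compose)
  then have cont: "continuous_map (top_of_set ?S) M (\<lambda>g. the (\<alpha> g x))" by (simp add: o_def)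
  have "closedin M {x}" using hausdorff x by (simp add: closedin_Hausdorff_singleton)
  from closedin_continuous_map_preimage[OF cont this]
  have closed: "closedin (top_of_set ?S) ?T" by simp
  obtain \<eta> where \<eta>: "\<eta> > 0" "\<And>g. det g = 1 \<Longrightarrow> norm (g - mat 1) < \<eta> \<Longrightarrow> \<alpha> g x = Some x"
    using fixed by (auto simp: locally_fixed_def)
  have "openin (top_of_set ?S) ?T"
    unfolding openin_euclidean_subtopology_iff
  proof (intro conjI ballI)
    fix g0 assume g0: "g0 \<in> ?T"
    let ?i = "matrix_inv g0"
    have SL: "g0 \<in> SL0" "?i \<in> SL0" using g0 dom(2) SL0_matrix_inv by blast+
    note i = matrix_inv_left_right[OF det_SL0[OF SL(1)]]
    have "isCont (\<lambda>g. g ** ?i) g0"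
      by (rule linear_continuous_at[OF bounded_linear_matrix_mult_right])
    then obtain d where d: "d > 0" "\<And>g. dist g g0 < d \<Longrightarrow> dist (g ** ?i) (g0 ** ?i) < \<eta>"
      using \<eta>(1) unfolding continuous_at_eps_delta by blast
    have "g \<in> ?T" if g: "g \<in> ?S" "dist g g0 < d" for g
    proof -
      let ?h = "g ** ?i"
      have h: "?h \<in> SL0" using SL dom(2)[OF g(1)] by (intro SL0_mult)
      have "\<alpha> ?h x = Some x"
        using d(2)[OF g(2)] i by (intro \<eta>(2) det_SL0 h) (simp add: dist_norm)
      moreover have "\<alpha> g0 x = Some x" using g0 dom(1)[of g0] by auto
      moreover have "?h ** g0 = g" using i by (simp add: matrix_mul_assoc[symmetric])
      ultimately have "the (\<alpha> g x) = x"
        using C1_local_actionD(2)[OF action h SL(1), of x x x] dom(1)[OF g(1)] by auto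
      then show ?thesis using g(1) by simp
    qed
    then show "\<exists>d>0. \<forall>g\<in>?S. dist g g0 < d \<longrightarrow> g \<in> ?T" using d(1) by blast
  qed auto
  with closed have "?T = {} \<or> ?T = ?S"
    using connected_connected_component[of "group_slice SL0 \<alpha> x" "mat 1"] unfolding connected_clopen by blast
  moreover have "mat 1 \<in> ?T"
  proof -
    have "\<alpha> (mat 1) x = Some x" using \<eta> by simp
    then show ?thesis using mat_1_in_SL0 by (auto simp: group_slice_def intro!: connected_component_refl)
  qed
  ultimately have "g \<in> ?T" using g by blast
  then show ?thesis using dom(1)[OF g] by auto
qed

theorem theorem5p3:
  fixes k :: "'n::finite"
    and M :: "'a topology"
    and A :: "('a, 'n) chart set"
    and \<alpha> :: "real^'m^'m \<Rightarrow> 'a \<rightharpoonup> 'a"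
  assumes dim: "CARD('m::finite) = CARD('n) + 1"
    and manifold: "analytic_manifold_with_boundary k M A"
    and boundary: "manifold_boundary k A \<noteq> {}"
    and action: "C1_local_action M A SL0 \<alpha>"
  shows "trivial_local_action SL0 (identity_part SL0 \<alpha>)
    \<and> ((\<forall>x\<in>topspace M. connected (group_slice SL0 \<alpha> x)) \<longrightarrow> trivial_local_action SL0 \<alpha>)"
proof -
  have "Hausdorff_space M"
    using manifold metrizable_imp_Hausdorff_space by (auto simp: analytic_manifold_with_boundary_def)
  then have comp: "\<alpha> g x = Some x"
    if "x \<in> topspace M" "g \<in> connected_component_set (group_slice SL0 \<alpha> x) (mat 1)" for g x
    by (rule slice_component_fixed[OF _ action that(1) locally_fixed_all[OF dim manifold boundary action that(1)] that(2)])
  have dom: "x \<in> topspace M" if "g \<in> SL0" "x \<in> dom (\<alpha> g)" for g x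
    using openin_subset[of M "dom (\<alpha> g)"] C1_local_actionD(1)[OF action that(1)] that(2)
    by (auto simp: C1_partial_diffeo_def)
  have "trivial_local_action SL0 (identity_part SL0 \<alpha>)"
    unfolding trivial_local_action_def
  proof (intro ballI)
    fix g :: "real^'m^'m" and x assume g: "g \<in> SL0" and x: "x \<in> dom (identity_part SL0 \<alpha> g)"
    then have "g \<in> connected_component_set (group_slice SL0 \<alpha> x) (mat 1)" "x \<in> dom (\<alpha> g)"
      by (auto simp: identity_part_def restrict_map_def split: if_splits)
    with comp[OF dom[OF g]] show "identity_part SL0 \<alpha> g x = Some x"
      by (simp add: identity_part_def restrict_map_def)
  qed
  moreover have "trivial_local_action SL0 \<alpha>" if con: "\<forall>x\<in>topspace M. connected (group_slice SL0 \<alpha> x)"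
    unfolding trivial_local_action_def
  proof (intro ballI)
    fix g :: "real^'m^'m" and x assume g: "g \<in> SL0" and x: "x \<in> dom (\<alpha> g)"
    have xM: "x \<in> topspace M" by (rule dom[OF g x])
    have "mat 1 \<in> group_slice SL0 \<alpha> x"
      using local_action_mat_1[OF action xM] mat_1_in_SL0 by (auto simp: group_slice_def)
    moreover have "g \<in> group_slice SL0 \<alpha> x" using g x by (simp add: group_slice_def)
    ultimately have "g \<in> connected_component_set (group_slice SL0 \<alpha> x) (mat 1)"
      using con xM connected_iff_connected_component by blast
    then show "\<alpha> g x = Some x" by (rule comp[OF xM])
  qed
  ultimately show ?thesis by blast
qed

end
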